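(* Let $\lambda_1,\lambda_2\in\mathbb{N}$, $\lambda=\lambda_1\varpi_1+\lambda_2\varpi_2$, and let $\pi_\lambda$ be the irreducible representation of $\mathcal{U}_q(\mathfrak{su}(3))$ on $V_\lambda$. Assume $c_1,c_2\in\mathbb{C}^\times$ satisfy $c_2c_1^{-1}\notin\{-q^{2\lambda_1+2\lambda_2+1-m}: m\in\mathbb{N}\}$. Then the restriction of $\pi_\lambda$ to $\mathcal{B}$ decomposes multiplicity free into irreducible representations: $\pi_\lambda|_{\mathcal{B}}\simeq\bigoplus_{(\kappa,n)}\tau_{(\kappa,n)}$, $V_\lambda=\bigoplus_{(\kappa,n)}W_{(\kappa,n)}$, where the sum runs over the pairwise distinct pairs $(\kappa,n)=(q^{\lambda_1-\lambda_2-3i},\,i+x)$ with $0\le i\le\lambda_1$ and $0\le x\le\lambda_2$.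
   Context: Fix $0<q<1$. $\mathcal{U}_q(\mathfrak{su}(3))$ denotes the unital associative $\mathbb{C}$-algebra generated by $E_i,F_i,K_i^{\pm1}$ ($i=1,2$) subject to: the $K_i^{\pm1}$ pairwise commute, $K_iK_i^{-1}=K_i^{-1}K_i=1$, $K_iE_j=q^{a_{ij}}E_jK_i$, $K_iF_j=q^{-a_{ij}}F_jK_i$, $E_iF_j-F_jE_i=\delta_{ij}\frac{K_i-K_i^{-1}}{q-q^{-1}}$, where $a_{11}=a_{22}=2$, $a_{12}=a_{21}=-1$, and for $i\neq j$ the quantum Serre relations $E_i^2E_j-(q+q^{-1})E_iE_jE_i+E_jE_i^2=0=F_i^2F_j-(q+q^{-1})F_iF_jF_i+F_jF_i^2$. For $\lambda_1,\lambda_2\in\mathbb{N}=\{0,1,2,\dots\}$, $V_\lambda$ is the finite-dimensional irreducible representation of $\mathcal{U}_q(\mathfrak{su}(3))$ generated by a vector $v_\lambda$ with $E_iv_\lambda=0$, $K_iv_\lambda=q^{\lambda_i}v_\lambda$. Let $c_1,c_2\in\mathbb{C}^\times$; $\mathcal{B}$ is the subalgebra generated by $K^{\pm1}=(K_1K_2^{-1})^{\pm1}$, $B_1=F_1-c_1E_2K_1^{-1}$, $B_2=F_2-c_2E_1K_2^{-1}$. A highest weight vector of weight $\kappa$ in a $\mathcal{B}$-representation $(\tau,W)$ is a nonzero $w_0$ with $\tau(B_1)w_0=0$, $\tau(K)w_0=\kappa w_0$. $(\tau_{(\kappa,n)},W_{(\kappa,n)})$ denotes the (unique up to equivalence) irreducible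 representation of $\mathcal{B}$ of dimension $n+1$ having a highest weight vector of weight $\kappa$. *)

theory Defs
  imports "HOL-Analysis.Analysis"
begin

text \<open>Representations on the finite-dimensional complex space complex^'n
 (dimension CARD('n), an arbitrary finite type). Operators are matrices acting by (*v).
 The generators E_i, F_i, K_i, K_i^{-1} (i = 1,2) are given as functions of i.\<close>

type_synonym ('n) cmat = "complex ^ ('n::finite) ^ 'n"

definition cmult :: "complex \<Rightarrow> ('n::finite) cmat \<Rightarrow> ('n::finite) cmat" where
  "cmult c A = (\<chi> i j. c * A $ i $ j)"

definition cartan :: "nat \<Rightarrow> nat \<Rightarrow> int" where
  "cartan i j = (if i = j then 2 else -1)"

definition Uq_rep :: "real \<Rightarrow> (nat \<Rightarrow> ('n::finite) cmat) \<Rightarrow> (nat \<Rightarrow> ('n::finite) cmat) \<Rightarrow>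
    (nat \<Rightarrow> ('n::finite) cmat) \<Rightarrow> (nat \<Rightarrow> ('n::finite) cmat) \<Rightarrow> bool" where
  "Uq_rep q E F K Ki \<longleftrightarrow>
     (let qc = complex_of_real q; Ks = K ` {1,2} \<union> Ki ` {1,2} in
     (\<forall>A\<in>Ks. \<forall>B\<in>Ks. A ** B = B ** A) \<and>
     (\<forall>i\<in>{1,2}. K i ** Ki i = mat 1 \<and> Ki i ** K i = mat 1) \<and>
     (\<forall>i\<in>{1,2}. \<forall>j\<in>{1,2}.
        K i ** E j = cmult (qc powi cartan i j) (E j ** K i) \<and>
        K i ** F j = cmult (qc powi (- cartan i j)) (F j ** K i) \<and>
        E i ** F j - F j ** E i =
          (if i = j then cmult (1 / (qc - inverse qc)) (K i - Ki i) else 0)) \<and>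
     (\<forall>i\<in>{1,2}. \<forall>j\<in>{1,2}. i \<noteq> j \<longrightarrow>
        E i ** E i ** E j - cmult (qc + inverse qc) (E i ** E j ** E i) + E j ** E i ** E i = 0 \<and>
        F i ** F i ** F j - cmult (qc + inverse qc) (F i ** F j ** F i) + F j ** F i ** F i = 0))"

definition invariant_subspace :: "('n::finite) cmat set \<Rightarrow> (complex ^ ('n::finite)) set \<Rightarrow> bool" where
  "invariant_subspace ops W \<longleftrightarrow> vec.subspace W \<and> (\<forall>A\<in>ops. \<forall>w\<in>W. A *v w \<in> W)"

definition irreducible_on :: "('n::finite) cmat set \<Rightarrow> (complex ^ ('n::finite)) set \<Rightarrow> bool" where
  "irreducible_on ops W \<longleftrightarrow> invariant_subspace ops W \<and> W \<noteq> {0} \<and>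
     (\<forall>U. invariant_subspace ops U \<and> U \<subseteq> W \<longrightarrow> U = {0} \<or> U = W)"

text \<open>Image of the generators of the coideal subalgebra B:
 K = K_1 K_2^{-1}, K^{-1}, B_1 = F_1 - c_1 E_2 K_1^{-1}, B_2 = F_2 - c_2 E_1 K_2^{-1}.\<close>
definition BK :: "(nat \<Rightarrow> ('n::finite) cmat) \<Rightarrow> (nat \<Rightarrow> ('n::finite) cmat) \<Rightarrow> ('n::finite) cmat" where
  "BK K Ki = K 1 ** Ki 2"
definition BKi :: "(nat \<Rightarrow> ('n::finite) cmat) \<Rightarrow> (nat \<Rightarrow> ('n::finite) cmat) \<Rightarrow> ('n::finite) cmat" where
  "BKi K Ki = K 2 ** Ki 1"
definition BB1 :: "complex \<Rightarrow> (nat \<Rightarrow> ('n::finite) cmat) \<Rightarrow> (nat \<Rightarrow> ('n::finite) cmat) \<Rightarrow> (nat \<Rightarrow> ('n::finite) cmat) \<Rightarrow> ('n::finite) cmat" where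
  "BB1 c1 E F Ki = F 1 - cmult c1 (E 2 ** Ki 1)"
definition BB2 :: "complex \<Rightarrow> (nat \<Rightarrow> ('n::finite) cmat) \<Rightarrow> (nat \<Rightarrow> ('n::finite) cmat) \<Rightarrow> (nat \<Rightarrow> ('n::finite) cmat) \<Rightarrow> ('n::finite) cmat" where
  "BB2 c2 E F Ki = F 2 - cmult c2 (E 1 ** Ki 2)"

definition B_ops :: "complex \<Rightarrow> complex \<Rightarrow> (nat \<Rightarrow> ('n::finite) cmat) \<Rightarrow> (nat \<Rightarrow> ('n::finite) cmat) \<Rightarrow>
    (nat \<Rightarrow> ('n::finite) cmat) \<Rightarrow> (nat \<Rightarrow> ('n::finite) cmat) \<Rightarrow> ('n::finite) cmat set" where
  "B_ops c1 c2 E F K Ki = {BK K Ki, BKi K Ki, BB1 c1 E F Ki, BB2 c2 E F Ki}"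

definition U_ops :: "(nat \<Rightarrow> ('n::finite) cmat) \<Rightarrow> (nat \<Rightarrow> ('n::finite) cmat) \<Rightarrow>
    (nat \<Rightarrow> ('n::finite) cmat) \<Rightarrow> (nat \<Rightarrow> ('n::finite) cmat) \<Rightarrow> ('n::finite) cmat set" where
  "U_ops E F K Ki = E ` {1,2} \<union> F ` {1,2} \<union> K ` {1,2} \<union> Ki ` {1,2}"

text \<open>The restriction of the B-representation to W is equivalent to tau_(kappa,n):
 W is B-irreducible, of dimension n+1, and has a highest weight vector of weight kappa.\<close>
definition is_tau :: "complex \<Rightarrow> complex \<Rightarrow> (nat \<Rightarrow> ('n::finite) cmat) \<Rightarrow> (nat \<Rightarrow> ('n::finite) cmat) \<Rightarrow>
    (nat \<Rightarrow> ('n::finite) cmat) \<Rightarrow> (nat \<Rightarrow> ('n::finite) cmat) \<Rightarrow> (complex ^ ('n::finite)) set \<Rightarrow> complex \<Rightarrow> nat \<Rightarrow> bool" where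
  "is_tau c1 c2 E F K Ki W \<kappa> n \<longleftrightarrow>
     irreducible_on (B_ops c1 c2 E F K Ki) W \<and> vec.dim W = n + 1 \<and>
     (\<exists>w\<in>W. w \<noteq> 0 \<and> BB1 c1 E F Ki *v w = 0 \<and> BK K Ki *v w = \<kappa> *s w)"

definition direct_sum_decomp :: "'i set \<Rightarrow> ('i \<Rightarrow> (complex ^ ('n::finite)) set) \<Rightarrow> bool" where
  "direct_sum_decomp I W \<longleftrightarrow>
     (\<forall>v :: complex ^ 'n. \<exists>!w. w \<in> (\<Pi>\<^sub>E j\<in>I. W j) \<and> v = (\<Sum>j\<in>I. w j))"

end

(*
  Put S = B_1 B_2 and T = B_2 B_1.  A Serre-type relation B_1^2 B_2 - [2] B_1 B_2 B_1 + B_2 B_1^2 = B_1 f(K)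
  makes S and T commute, and moving S and T through powers of B_1 or B_2 on a fixed weight space of K yields
  commuting operators t_m = [m] T - [m-1] S + const (m an integer) with B_2^k B_1^k = t_1 ... t_k and
  B_1^k B_2^k = t_0 t_{-1} ... t_{1-k}.  Since B_1^(l1+1) and B_2^(l2+1) kill the highest weight vector v, it is
  annihilated by t_1 ... t_{l1+1} and by t_0 ... t_{-l2}.  On the joint kernel of t_{i+1} and t_{-x} the operator t_m
  is an explicit scalar, nonzero for all other m in the range by the condition on c2/c1, so interpolation writes v
  as a sum of vectors e_{i,x} in these joint kernels; each e_{i,x} spans with its B_1- and B_2-images an irreducible
  of type (q^(l1-l2-3i), i+x), and V = B v.  No e_{i,x} vanishes: otherwise a product of l1+l2 of the t_m kills v, hence so
  does its leading part (the case c1 = c2 = 0), and exchanging factors by the three-term relation among the t_m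
  reduces this to the vanishing of F_2^l1 F_1^(l1+l2) F_2^l2 v, a nonzero extremal weight vector.
*)
theory Submission
  imports Defs
begin

section \<open>Modules over the quantum group and the Serre-type relations of the coideal\<close>

text \<open>The operators t_m are governed by one second-order recurrence, x(m+1) = [2] x(m) -
  x(m-1) + inhomogeneity, which is the Serre-type relation read on successive weight spaces. Its
  homogeneous solutions form a plane spanned by [m] and [m-1], so up to a scalar each t_m is a
  combination of any two t_a, t_b. This is why two kernel conditions fix the action of all t_m. The
  scalar is [a-m] [m-b] times one further factor, the only one that involves c1 and c2. The sum is
  direct because K, S and T together separate all positions in all strings: two consecutive
  eigenvalues determine the whole sequence, and its zeros recover i and x. V = B v holds because F_i
  differs from B_i by a multiple of E_j K_i^-1, which shortens words in the F's applied to v. The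
  diagram symmetry exchanging 1 and 2 reflects m to 1 - m and carries results on powers of B_1 over
  to powers of B_2.\<close>

lemma lin_simps:
  assumes "Vector_Spaces.linear (*s) (*s) (f :: complex^'n::finite \<Rightarrow> complex^'n)"
  shows "f (x + y) = f x + f y" "f (x - y) = f x - f y" "f (a *s x) = a *s f x"
    "f 0 = 0" "f (- x) = - f x"
  using vec.linear_add[OF assms] vec.linear_diff[OF assms] vec.linear_scale[OF assms]
    vec.linear_0[OF assms] vec.linear_neg[OF assms] by auto

lemma linear_funpow:
  assumes "Vector_Spaces.linear (*s) (*s) (f :: complex^'n::finite \<Rightarrow> complex^'n)"
  shows "Vector_Spaces.linear (*s) (*s) (f ^^ k)"
proof (induction k)
  case 0
  show ?case by (simp add: Vector_Spaces.linear_iff vec.vector_space_axioms)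
next
  case (Suc k)
  show ?case using Vector_Spaces.linear_compose[OF Suc assms] by (simp add: comp_def)
qed

lemmas funpow_linear = lin_simps[OF linear_funpow]

text \<open>Conjugating a scaling relation by an inverse operator; \<open>me\<close> and
  \<open>mf\<close> obtain the relations for \<open>m1\<close>, \<open>m2\<close> from
  \<open>ke\<close> and \<open>kf\<close> in this way.\<close>

lemma inverse_commute_scale:
  fixes A A' B :: "complex ^ 'n::finite \<Rightarrow> complex ^ 'n"
  assumes lin: "Vector_Spaces.linear (*s) (*s) A'" "Vector_Spaces.linear (*s) (*s) B"
    and inv: "\<And>x. A (A' x) = x" "\<And>x. A' (A x) = x"
    and AB: "\<And>x. A (B x) = a *s B (A x)" and a: "a * b = 1"
  shows "A' (B x) = b *s B (A' x)"
proof -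
  have "B (A' x) = A' (A (B (A' x)))" by (simp add: inv)
  also have "\<dots> = a *s A' (B x)" by (simp add: AB lin_simps[OF lin(1)] inv)
  finally show ?thesis using a by (simp add: vec.scale_scale mult.commute)
qed

lemma diff_add_eq_imp: "x - y + z = w \<Longrightarrow> z = y - x + w" for w x y z :: "'a::ab_group_add"
  by (auto simp: algebra_simps)

lemma diff_add_eq_cancel: "x - y + z = w \<Longrightarrow> z' - y + x = w' \<Longrightarrow> w = w' \<Longrightarrow> z' = z"
  for w w' x y z z' :: "'a::ab_group_add"
  by (auto simp: algebra_simps) (metis add_left_cancel)

text \<open>The generators are plain functions, with \<open>m1\<close>, \<open>m2\<close> standing
  for the inverses of \<open>k1\<close>, \<open>k2\<close>, so that exchanging the indices 1 and 2
  is again an instance of the locale. \<open>qroot\<close> says that \<open>q\<close> is not a root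
  of unity; it keeps quantum integers nonzero and weights distinct.\<close>

locale uq_module =
  fixes q :: complex
    and e1 e2 f1 f2 k1 k2 m1 m2 :: "complex ^ 'n::finite \<Rightarrow> complex ^ 'n"
  assumes q0: "q \<noteq> 0" and qroot: "k \<noteq> 0 \<Longrightarrow> q powi k \<noteq> 1"
    and lin: "Vector_Spaces.linear (*s) (*s) e1" "Vector_Spaces.linear (*s) (*s) e2"
      "Vector_Spaces.linear (*s) (*s) f1" "Vector_Spaces.linear (*s) (*s) f2"
      "Vector_Spaces.linear (*s) (*s) k1" "Vector_Spaces.linear (*s) (*s) k2"
      "Vector_Spaces.linear (*s) (*s) m1" "Vector_Spaces.linear (*s) (*s) m2"
    and kk: "k2 (k1 x) = k1 (k2 x)" "m2 (m1 x) = m1 (m2 x)"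
      "k2 (m1 x) = m1 (k2 x)" "m2 (k1 x) = k1 (m2 x)"
    and km: "k1 (m1 x) = x" "m1 (k1 x) = x" "k2 (m2 x) = x" "m2 (k2 x) = x"
    and ke: "k1 (e1 x) = (q ^ 2) *s e1 (k1 x)" "k2 (e2 x) = (q ^ 2) *s e2 (k2 x)"
      "k1 (e2 x) = inverse q *s e2 (k1 x)" "k2 (e1 x) = inverse q *s e1 (k2 x)"
    and kf: "k1 (f1 x) = (inverse q ^ 2) *s f1 (k1 x)" "k2 (f2 x) = (inverse q ^ 2) *s f2 (k2 x)"
      "k1 (f2 x) = q *s f2 (k1 x)" "k2 (f1 x) = q *s f1 (k2 x)"
    and ef: "e1 (f1 x) = f1 (e1 x) + (1 / (q - inverse q)) *s (k1 x - m1 x)"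
      "e2 (f2 x) = f2 (e2 x) + (1 / (q - inverse q)) *s (k2 x - m2 x)"
      "e1 (f2 x) = f2 (e1 x)" "e2 (f1 x) = f1 (e2 x)"
    and serre_e: "e1 (e1 (e2 x)) - (q + inverse q) *s e1 (e2 (e1 x)) + e2 (e1 (e1 x)) = 0"
      "e2 (e2 (e1 x)) - (q + inverse q) *s e2 (e1 (e2 x)) + e1 (e2 (e2 x)) = 0"
    and serre_f: "f1 (f1 (f2 x)) - (q + inverse q) *s f1 (f2 (f1 x)) + f2 (f1 (f1 x)) = 0"
      "f2 (f2 (f1 x)) - (q + inverse q) *s f2 (f1 (f2 x)) + f1 (f2 (f2 x)) = 0"
begin

text \<open>The diagram automorphism. It exchanges \<open>b1\<close> with \<open>b2\<close> and
  \<open>bK\<close> with its inverse \<open>bM\<close> (see \<open>swap_defs\<close>).\<close>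

lemma swap: "uq_module q e2 e1 f2 f1 k2 k1 m2 m1"
  by (intro uq_module.intro) (fact q0 qroot lin kk[symmetric] km ke kf ef serre_e serre_f)+

lemmas linear_simps = lin[THEN lin_simps(1)] lin[THEN lin_simps(2)] lin[THEN lin_simps(3)]
  lin[THEN lin_simps(4)] lin[THEN lin_simps(5)]

lemma q_powers: "q ^ 2 * inverse q ^ 2 = 1" "inverse q ^ 2 * q ^ 2 = 1" "q * inverse q = 1" "inverse q * q = 1"
  using q0 by (simp_all add: field_simps)

lemmas me = inverse_commute_scale[OF lin(7) lin(1) km(1,2) ke(1) q_powers(1)]
    inverse_commute_scale[OF lin(8) lin(2) km(3,4) ke(2) q_powers(1)]
    inverse_commute_scale[OF lin(7) lin(2) km(1,2) ke(3) q_powers(4)]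
    inverse_commute_scale[OF lin(8) lin(1) km(3,4) ke(4) q_powers(4)]

lemmas mf = inverse_commute_scale[OF lin(7) lin(3) km(1,2) kf(1) q_powers(2)]
    inverse_commute_scale[OF lin(8) lin(4) km(3,4) kf(2) q_powers(2)]
    inverse_commute_scale[OF lin(7) lin(4) km(1,2) kf(3) q_powers(3)]
    inverse_commute_scale[OF lin(8) lin(3) km(3,4) kf(4) q_powers(3)]

lemma q2: "q * q \<noteq> 1" "q ^ 2 \<noteq> 1" "q - inverse q \<noteq> 0"
  using qroot[of 2] q0 by (auto simp: power2_eq_square field_simps)

definition bK :: "complex ^ 'n \<Rightarrow> complex ^ 'n" where "bK x = k1 (m2 x)"
definition bM :: "complex ^ 'n \<Rightarrow> complex ^ 'n" where "bM x = k2 (m1 x)"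
definition b1 :: "complex \<Rightarrow> complex ^ 'n \<Rightarrow> complex ^ 'n" where "b1 c x = f1 x - c *s e2 (m1 x)"
definition b2 :: "complex \<Rightarrow> complex ^ 'n \<Rightarrow> complex ^ 'n" where "b2 c x = f2 x - c *s e1 (m2 x)"

text \<open>\<open>b1\<close> contains \<open>f1\<close> and \<open>e2\<close>, \<open>b2\<close>
  contains \<open>f2\<close> and \<open>e1\<close>; a word with two \<open>b1\<close> and one
  \<open>b2\<close> therefore meets this Serre relation and the next one, both oriented as rewrite
  rules.\<close>

lemma serre_f_rw: "f1 (f1 (f2 x)) = (q + inverse q) *s f1 (f2 (f1 x)) - f2 (f1 (f1 x))"
  using serre_f(1)[of x] by (simp add: algebra_simps)
lemma serre_e_rw: "e2 (e2 (e1 x)) = (q + inverse q) *s e2 (e1 (e2 x)) - e1 (e2 (e2 x))"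
  using serre_e(2)[of x] by (simp add: algebra_simps)

text \<open>The terms purely in the \<open>f\<close> or purely in the \<open>e\<close> cancel by the
  quantum Serre relations. Reordering the mixed terms produces commutators of \<open>e1\<close>,
  \<open>f1\<close> and of \<open>e2\<close>, \<open>f2\<close>, and what survives of these is the
  right-hand side.\<close>

lemma serre_b1:
  "b1 a1 (b1 a1 (b2 a2 x)) - (q + inverse q) *s b1 a1 (b2 a2 (b1 a1 x)) + b2 a2 (b1 a1 (b1 a1 x))
   = (q + inverse q) *s b1 a1 ((a2 * inverse q ^ 2) *s bK x + (a1 * q) *s bM x)"
proof -
  define p where "p = inverse q"
  define d where "d = 1 / (q - p)"
  txt \<open>Rewriting with the next rules gives a normal form for coefficients in \<open>q\<close>, \<open>p\<close> and \<open>d\<close>.\<close>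
  have pq: "p * q = 1" "\<And>z. p * (q * z) = z" using q0 by (simp_all add: p_def)
  have dqp: "d * (q - p) = 1" using q2(3) by (simp add: d_def p_def)
  have dq: "d * q = 1 + d * p" "\<And>z. d * (q * z) = z + d * (p * z)"
    subgoal using dqp by (simp add: algebra_simps)
    subgoal for z using arg_cong[OF dqp, of "\<lambda>t. t * z"] by (simp add: algebra_simps)
    done
  have dp: "d * (p * p) = d - p" "\<And>z. d * (p * (p * z)) = d * z - p * z"
    subgoal using arg_cong[OF dqp, of "\<lambda>t. t * p"] by (simp add: algebra_simps pq)
    subgoal for z using arg_cong[OF dqp, of "\<lambda>t. t * (p * z)"] by (simp add: algebra_simps pq)
    done
  note rules = me mf ke kf ef kk km serre_f_rw serre_e_rw
  show ?thesis
    by (simp only: b1_def b2_def bK_def bM_def linear_simps rules[folded p_def, folded d_def],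
        simp only: p_def[symmetric] power2_eq_square, simp only: vec_eq_iff)
      (simp add: algebra_simps pq dq dp)
qed

section \<open>Quantum integers and the scalar recurrence\<close>

definition qint :: "int \<Rightarrow> complex" where
  "qint m = (q powi m - inverse (q powi m)) / (q - inverse q)"

text \<open>Taken from the right-hand side of \<open>serre_b1\<close>: on weight \<open>k\<close>
  the operators \<open>bK\<close> and \<open>bM\<close> act as \<open>q^k\<close> and
  \<open>q^-k\<close>, which leaves this multiple of \<open>b1 c1 x\<close>.\<close>

definition serre_coeff :: "complex \<Rightarrow> complex \<Rightarrow> int \<Rightarrow> complex" where
  "serre_coeff c1 c2 k = (q + inverse q) * (c2 * q powi (k - 2) + c1 * q powi (1 - k))"

text \<open>A particular solution of the inhomogeneous recurrence satisfied by the operators \<open>string_op\<close> below.\<close>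
definition string_offset :: "complex \<Rightarrow> complex \<Rightarrow> int \<Rightarrow> int \<Rightarrow> complex" where
  "string_offset c1 c2 h m = (c1 * q powi (3 * m - h - 2) + c2 * q powi (h + 1 - 3 * m)) / (q - inverse q)\<^sup>2"

text \<open>The eigenvalue of the \<open>m\<close>-th operator \<open>string_op\<close> on the joint kernel of the \<open>a\<close>-th and \<open>b\<close>-th one; the summand with
  index \<open>(i, x)\<close> of the theorem corresponds to \<open>a = i + 1\<close>, \<open>b = - x\<close>.\<close>
definition string_ev :: "complex \<Rightarrow> complex \<Rightarrow> int \<Rightarrow> int \<Rightarrow> int \<Rightarrow> int \<Rightarrow> complex" where
  "string_ev c1 c2 h a b m = - (qint (a - m) * qint (m - b) *
     (c1 * q powi (a + b + m - h - 2) + c2 * q powi (h + 1 - a - b - m)))"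

lemma powi_simps:
  "q powi (m + n) = q powi m * q powi n" "q powi (m - n) = q powi m * inverse (q powi n)"
  "q powi (- n) = inverse (q powi n)" "q powi (numeral w * n) = (q powi n) ^ numeral w"
  "q powi n \<noteq> 0" "q powi (n * numeral w) = (q powi n) ^ numeral w"
  using q0 by (auto simp: power_int_add power_int_diff power_int_minus field_simps power_int_mult
      mult.commute[of "numeral w" n] )

lemma qint_simps [simp]: "qint 0 = 0" "qint 1 = 1" "qint (- m) = - qint m"
proof -
  show "qint 0 = 0" by (simp add: qint_def)
  show "qint 1 = 1" using q2 by (simp add: qint_def)
  show "qint (- m) = - qint m" by (simp add: qint_def powi_simps minus_divide_left)
qed

lemma qint_two: "qint 2 = q + inverse q"
  using q0 q2 by (simp add: qint_def field_simps power2_eq_square)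

lemma qint_eq_0_iff [simp]: "qint m = 0 \<longleftrightarrow> m = 0"
proof
  assume "qint m = 0"
  then have *: "q powi m = inverse (q powi m)" using q2 by (simp add: qint_def)
  have "q powi (2 * m) = q powi m * q powi m" by (simp only: mult_2 powi_simps)
  also have "\<dots> = q powi m * inverse (q powi m)" by (rule arg_cong[OF *])
  finally have "q powi (2 * m) = 1" by (simp only: right_inverse[OF powi_simps(5)])
  then show "m = 0" using qroot[of "2 * m"] by auto
qed auto

text \<open>As functions of \<open>m\<close> both sides solve x(m+1) = [2] x(m) - x(m-1) and agree
  at \<open>a\<close> and \<open>b\<close>: interpolation in a two-dimensional space. The proof
  checks the corresponding rational identity in powers of \<open>q\<close>.\<close>

lemma qint_three_term: "qint (a - b) * qint m = qint (m - b) * qint a + qint (a - m) * qint b"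
proof -
  have "(A * inverse B - inverse (A * inverse B)) * (M - inverse M) =
     (M * inverse B - inverse (M * inverse B)) * (A - inverse A) +
     (A * inverse M - inverse (A * inverse M)) * (B - inverse B)"
    if "A \<noteq> 0" "B \<noteq> 0" "M \<noteq> 0" for A B M :: complex
    using that by (simp add: field_simps)
  from this[OF powi_simps(5) powi_simps(5) powi_simps(5), of a b m] show ?thesis
    using q2 by (simp add: qint_def powi_simps add_divide_distrib[symmetric])
qed

text \<open>On \<open>q^(3m)\<close> and \<open>q^(-3m)\<close> the homogeneous recurrence operator
  acts as q^3 - (q + q^-1) + q^-3 = (q + q^-1) (q - q^-1)^2, which is where the denominator of
  \<open>string_offset\<close> comes from.\<close>

lemma string_offset_rec:
  "string_offset c1 c2 h (m + 1) = (q + inverse q) * string_offset c1 c2 h m - string_offset c1 c2 h (m - 1)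
    + serre_coeff c1 c2 (h - 3 * (m - 1))"
proof -
  let ?M = "q powi m" and ?H = "q powi h" and ?p = "inverse q"
  let ?N = "inverse ?M" and ?I = "inverse ?H"
  have "?p * q = 1" using q0 by simp
  then have "c1 * (?M ^ 3 * q ^ 3 * ?I * ?p ^ 2) + c2 * (?H * q * (?N ^ 3 * ?p ^ 3)) =
    (q + ?p) * (c1 * (?M ^ 3 * ?I * ?p ^ 2) + c2 * (?H * q * ?N ^ 3)) -
    (c1 * (?M ^ 3 * ?p ^ 3 * ?I * ?p ^ 2) + c2 * (?H * q * (?N ^ 3 * q ^ 3))) +
    (q - ?p)\<^sup>2 * ((q + ?p) * (c2 * (?H * q * ?N ^ 3) + c1 * (?I * ?p ^ 2 * ?M ^ 3)))"
    by algebra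
  moreover have string_offset: "string_offset c1 c2 h n =
      (c1 * ((q powi n) ^ 3 * ?I * ?p ^ 2) + c2 * (?H * q * inverse (q powi n) ^ 3)) / (q - ?p)\<^sup>2" for n
    by (simp add: string_offset_def powi_simps power_inverse)
  moreover have "serre_coeff c1 c2 (h - 3 * (m - 1)) =
    (q + ?p) * (c2 * (?H * q * ?N ^ 3) + c1 * (?I * ?p ^ 2 * ?M ^ 3))"
  proof -
    have "h - 3 * (m - 1) - 2 = h + 1 - 3 * m" "1 - (h - 3 * (m - 1)) = 3 * m - h - 2" by simp_all
    then show ?thesis by (simp only: serre_coeff_def) (simp add: powi_simps power_inverse)
  qed
  moreover have "string_offset c1 c2 h (m + 1) =
      (c1 * (?M ^ 3 * q ^ 3 * ?I * ?p ^ 2) + c2 * (?H * q * (?N ^ 3 * ?p ^ 3))) / (q - ?p)\<^sup>2"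
    "string_offset c1 c2 h (m - 1) =
      (c1 * (?M ^ 3 * ?p ^ 3 * ?I * ?p ^ 2) + c2 * (?H * q * (?N ^ 3 * q ^ 3))) / (q - ?p)\<^sup>2"
    by (simp_all add: string_offset powi_simps power_inverse power_mult_distrib)
  moreover have "x / d = s * (y / d) - z / d + f" if "x = s * y - z + d * f" "d \<noteq> 0" for x y z s f d :: complex
    using that by (simp add: field_simps)
  ultimately show ?thesis using q2(3) by simp
qed

text \<open>As a function of \<open>m\<close>, \<open>string_ev\<close> is the solution of the
  inhomogeneous recurrence that vanishes at \<open>a\<close> and \<open>b\<close>: the particular
  solution minus its interpolation from these two nodes. The content is that this difference
  factors.\<close>

lemma string_ev_eq:
  assumes "a \<noteq> b"
  shows "string_ev c1 c2 h a b m = string_offset c1 c2 h m -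
    (qint (m - b) * string_offset c1 c2 h a + qint (a - m) * string_offset c1 c2 h b) / qint (a - b)"
proof -
  let ?C = "c1 * inverse (q powi h) * inverse q ^ 2" and ?D = "c2 * q powi h * q" and ?d = "q - inverse q"
  have "(A * inverse B - inverse A * B) * (A * inverse M - inverse A * M) * (M * inverse B - inverse M * B)
     * (C * (A * B * M) + D * (inverse A * inverse B * inverse M)) =
     (M * inverse B - inverse M * B) * (C * A ^ 3 + D * inverse A ^ 3)
     + (A * inverse M - inverse A * M) * (C * B ^ 3 + D * inverse B ^ 3)
     - (A * inverse B - inverse A * B) * (C * M ^ 3 + D * inverse M ^ 3)"
    if "A \<noteq> 0" "B \<noteq> 0" "M \<noteq> 0" for A B M C D :: complex
  proof -
    have "inverse A * A = 1" "inverse B * B = 1" "inverse M * M = 1" using that by simp_all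
    then show ?thesis by algebra
  qed
  note identity = this[OF powi_simps(5) powi_simps(5) powi_simps(5), of a b m ?C ?D]
  have string_offset: "string_offset c1 c2 h n = (?C * (q powi n) ^ 3 + ?D * inverse (q powi n) ^ 3) / ?d\<^sup>2" for n
    by (simp add: string_offset_def powi_simps power_inverse algebra_simps)
  have qint: "qint (n - l) = (q powi n * inverse (q powi l) - inverse (q powi n) * q powi l) / ?d" for n l
    by (simp add: qint_def powi_simps mult.commute)
  have string_ev: "string_ev c1 c2 h a b m = - (qint (a - m) * qint (m - b) * (?C * (q powi a * q powi b * q powi m) +
     ?D * (inverse (q powi a) * inverse (q powi b) * inverse (q powi m))))"
    by (simp add: string_ev_def powi_simps power_inverse algebra_simps)
  have "qint (a - b) * string_ev c1 c2 h a b m = qint (a - b) * string_offset c1 c2 h m -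
      (qint (m - b) * string_offset c1 c2 h a + qint (a - m) * string_offset c1 c2 h b)"
    unfolding string_ev unfolding string_offset qint using arg_cong[OF identity, of "\<lambda>t. - t / ?d ^ 3"] q2(3)
    by (simp add: power2_eq_square power3_eq_cube divide_simps) (simp add: algebra_simps)
  then show ?thesis using assms by (simp add: field_simps)
qed

section \<open>Weight spaces of K and the Serre-type relations on them\<close>

lemma bK_b1: "bK (b1 c x) = inverse q ^ 3 *s b1 c (bK x)"
  and bK_b2: "bK (b2 c x) = q ^ 3 *s b2 c (bK x)"
  and bM_b2: "bM (b2 c x) = inverse q ^ 3 *s b2 c (bM x)"
  using q0 by (simp_all only: b1_def b2_def bK_def bM_def linear_simps me mf ke kf kk km)
    (simp_all add: vec_eq_iff field_simps power2_eq_square power3_eq_cube)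

lemma b_linear: "b1 c (x + y) = b1 c x + b1 c y" "b1 c (x - y) = b1 c x - b1 c y"
  "b1 c (a *s x) = a *s b1 c x" "b1 c 0 = 0"
  "b2 c (x + y) = b2 c x + b2 c y" "b2 c (x - y) = b2 c x - b2 c y"
  "b2 c (a *s x) = a *s b2 c x" "b2 c 0 = 0"
  "bK (x + y) = bK x + bK y" "bK (x - y) = bK x - bK y" "bK (a *s x) = a *s bK x" "bK 0 = 0"
  "bM (x + y) = bM x + bM y" "bM (x - y) = bM x - bM y" "bM (a *s x) = a *s bM x" "bM 0 = 0"
  by (simp_all add: b1_def b2_def bK_def bM_def linear_simps vec_eq_iff algebra_simps)

lemma b_lin: "Vector_Spaces.linear (*s) (*s) (b1 c)" "Vector_Spaces.linear (*s) (*s) (b2 c)"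
    "Vector_Spaces.linear (*s) (*s) bK" "Vector_Spaces.linear (*s) (*s) bM"
  by (simp_all add: Vector_Spaces.linear_iff b_linear vec.vector_space_axioms)

lemma b_inverse: "bK (bM x) = x" "bM (bK x) = x"
  by (simp_all add: bK_def bM_def km kk)

lemma swap_defs: "uq_module.b1 e1 f2 m2 = b2" "uq_module.b2 e2 f1 m1 = b1"
  "uq_module.bK k2 m1 = bM" "uq_module.bM k1 m2 = bK"
  by (simp_all add: fun_eq_iff b1_def b2_def bK_def bM_def uq_module.b1_def[OF swap] uq_module.b2_def[OF swap]
    uq_module.bK_def[OF swap] uq_module.bM_def[OF swap])

lemmas serre_b2 = uq_module.serre_b1[OF swap, unfolded swap_defs]

text \<open>\<open>serre_b1\<close> at \<open>b2 c2 x\<close> and \<open>b1 c1\<close> applied to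
  \<open>serre_b2\<close> at \<open>x\<close> share their first and middle terms, and their
  right-hand sides agree once \<open>bK\<close> and \<open>bM\<close> are moved past
  \<open>b2\<close>.\<close>

lemma b1b2_commute: "b1 c1 (b2 c2 (b2 c2 (b1 c1 x))) = b2 c2 (b1 c1 (b1 c1 (b2 c2 x)))"
proof -
  let ?B = "b1 c1" and ?C = "b2 c2"
  have h1: "?B (?B (?C (?C x))) - (q + inverse q) *s ?B (?C (?B (?C x))) + ?C (?B (?B (?C x))) =
    (q + inverse q) *s ?B ((c2 * inverse q ^ 2) *s bK (?C x) + (c1 * q) *s bM (?C x))"
    by (rule serre_b1)
  have h2: "?B (?C (?C (?B x))) - (q + inverse q) *s ?B (?C (?B (?C x))) + ?B (?B (?C (?C x))) =
    (q + inverse q) *s ?B (?C ((c1 * inverse q ^ 2) *s bM x + (c2 * q) *s bK x))"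
    using arg_cong[OF serre_b2[of c2 c1 x], of ?B] by (simp add: b_linear)
  have h3: "(c2 * inverse q ^ 2) *s bK (?C x) + (c1 * q) *s bM (?C x) =
      ?C ((c1 * inverse q ^ 2) *s bM x + (c2 * q) *s bK x)"
    using q0 by (simp add: b_linear bK_b2 bM_b2 vec_eq_iff field_simps power2_eq_square power3_eq_cube)
  show ?thesis by (rule diff_add_eq_cancel[OF h1 h2]) (simp only: h3)
qed

definition weight :: "int \<Rightarrow> (complex ^ 'n) set" where "weight k = {y. bK y = q powi k *s y}"

lemma weight_bM: "y \<in> weight k \<Longrightarrow> bM y = inverse (q powi k) *s y"
proof -
  assume "y \<in> weight k"
  then have "y = q powi k *s bM y" by (metis (mono_tags) weight_def mem_Collect_eq b_linear(15) b_inverse(2))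
  then have "inverse (q powi k) *s y = (inverse (q powi k) * q powi k) *s bM y" by (metis vec.scale_scale)
  then show ?thesis using left_inverse[OF powi_simps(5), of k] by (metis vec.scale_one)
qed

lemma weight_closed: "0 \<in> weight k" "x \<in> weight k \<Longrightarrow> y \<in> weight k \<Longrightarrow> x + y \<in> weight k"
  "x \<in> weight k \<Longrightarrow> y \<in> weight k \<Longrightarrow> x - y \<in> weight k" "x \<in> weight k \<Longrightarrow> a *s x \<in> weight k"
  by (auto simp: weight_def b_linear vec_eq_iff algebra_simps)

lemma weight_b1: "y \<in> weight k \<Longrightarrow> b1 c y \<in> weight (k - 3)"
  and weight_b2: "y \<in> weight k \<Longrightarrow> b2 c y \<in> weight (k + 3)"
  using q0 by (simp_all add: weight_def bK_b1 bK_b2 b_linear powi_simps field_simps power_inverse)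

text \<open>On a weight space the Serre-type relation can be solved with a factor
  \<open>b1 c1\<close> in front. Applied to \<open>y\<close> in the \<open>b1\<close>-orbit of a
  fixed vector, it becomes the recurrence \<open>string_op_rec\<close>.\<close>

lemma b2_b1_b1:
  assumes "y \<in> weight k"
  shows "b2 c2 (b1 c1 (b1 c1 y)) =
    b1 c1 ((q + inverse q) *s b2 c2 (b1 c1 y) - b1 c1 (b2 c2 y) + serre_coeff c1 c2 k *s y)"
proof -
  have "bK y = q powi k *s y" using assms by (simp add: weight_def)
  moreover have "serre_coeff c1 c2 k = (q + inverse q) * (c2 * inverse q ^ 2 * q powi k + c1 * q * inverse (q powi k))"
    using q0 by (simp add: serre_coeff_def powi_simps power_inverse field_simps)
  ultimately show ?thesis using diff_add_eq_imp[OF serre_b1[of c1 c2 y]] weight_bM[OF assms]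
    by (simp add: b_linear) (simp add: vec_eq_iff algebra_simps)
qed

lemma b1_b2_b2:
  assumes "y \<in> weight k"
  shows "b1 c1 (b2 c2 (b2 c2 y)) =
    b2 c2 ((q + inverse q) *s b1 c1 (b2 c2 y) - b2 c2 (b1 c1 y) + serre_coeff c1 c2 (k + 3) *s y)"
proof -
  have "bK y = q powi k *s y" using assms by (simp add: weight_def)
  moreover have "serre_coeff c1 c2 (k + 3) = (q + inverse q) * (c1 * inverse q ^ 2 * inverse (q powi k) + c2 * q * (q powi k))"
    using q0 by (simp add: serre_coeff_def powi_simps field_simps power2_eq_square power3_eq_cube)
  ultimately show ?thesis using diff_add_eq_imp[OF serre_b2[of c2 c1 y]] weight_bM[OF assms]
    by (simp add: b_linear) (simp add: vec_eq_iff algebra_simps)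
qed
end

section \<open>The operators attached to a string\<close>

context uq_module begin

lemma qint_rec: "qint (m + 1) = (q + inverse q) * qint m - qint (m - 1)"
  using qint_three_term[of m "m - 1" "m + 1"] qint_simps(3)[of 1] by (simp add: qint_two)

text \<open>These are the operators \<open>t\<^sub>m\<close>; their constants are adapted to vectors of weight \<open>h\<close>.\<close>
definition string_op :: "complex \<Rightarrow> complex \<Rightarrow> int \<Rightarrow> int \<Rightarrow> complex ^ 'n \<Rightarrow> complex ^ 'n" where
  "string_op c1 c2 h m y = qint m *s b2 c2 (b1 c1 y) - qint (m - 1) *s b1 c1 (b2 c2 y)
     + (string_offset c1 c2 h m - qint m * string_offset c1 c2 h 1 + qint (m - 1) * string_offset c1 c2 h 0) *s y"

lemma string_op_linear: "string_op c1 c2 h m (x + y) = string_op c1 c2 h m x + string_op c1 c2 h m y"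
  "string_op c1 c2 h m (x - y) = string_op c1 c2 h m x - string_op c1 c2 h m y"
  "string_op c1 c2 h m (a *s x) = a *s string_op c1 c2 h m x" "string_op c1 c2 h m 0 = 0"
  by (simp_all add: string_op_def b_linear vec_eq_iff algebra_simps)

lemma string_op_commute: "string_op c1 c2 h m (string_op c1 c2 h n y) = string_op c1 c2 h n (string_op c1 c2 h m y)"
  by (simp add: string_op_def b_linear b1b2_commute vec_eq_iff algebra_simps)

lemma string_op_weight: "y \<in> weight k \<Longrightarrow> string_op c1 c2 h m y \<in> weight k"
  using weight_b1[OF weight_b2, of y k c1 c2] weight_b2[OF weight_b1, of y k c2 c1] by (simp add: string_op_def weight_closed)

lemma string_op_0_1: "string_op c1 c2 h 0 y = b1 c1 (b2 c2 y)" "string_op c1 c2 h 1 y = b2 c2 (b1 c1 y)"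
  using qint_simps(3)[of 1] by (simp_all add: string_op_def)

lemma string_op_rec: "string_op c1 c2 h (m + 1) y =
    (q + inverse q) *s string_op c1 c2 h m y - string_op c1 c2 h (m - 1) y + serre_coeff c1 c2 (h - 3 * (m - 1)) *s y"
proof -
  have *: "qint (m - 1 - 1) = (q + inverse q) * qint (m - 1) - qint m" using qint_rec[of "m - 1"] by simp
  show ?thesis unfolding string_op_def add_diff_cancel_right' qint_rec[of m] string_offset_rec *
    by (simp add: vec_eq_iff algebra_simps)
qed

text \<open>The coefficients \<open>qint m\<close> and \<open>qint (m - 1)\<close> interpolate
  exactly from the nodes \<open>a\<close> and \<open>b\<close>; the offset does not, and its defect
  is \<open>string_ev\<close>.\<close>

lemma string_op_three_term:
  assumes "a \<noteq> b"
  shows "string_op c1 c2 h m y = (qint (m - b) / qint (a - b)) *s string_op c1 c2 h a y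
    + (qint (a - m) / qint (a - b)) *s string_op c1 c2 h b y + string_ev c1 c2 h a b m *s y"
proof -
  let ?u = "qint (m - b) / qint (a - b)" and ?v = "qint (a - m) / qint (a - b)"
  have 1: "qint m = ?u * qint a + ?v * qint b"
    using qint_three_term[of a b m] assms by (simp add: field_simps)
  have 2: "qint (m - 1) = ?u * qint (a - 1) + ?v * qint (b - 1)"
    using qint_three_term[of "a - 1" "b - 1" "m - 1"] assms by (simp add: field_simps)
  have 3: "string_ev c1 c2 h a b m = string_offset c1 c2 h m - (?u * string_offset c1 c2 h a + ?v * string_offset c1 c2 h b)"
    using string_ev_eq[OF assms] by (simp add: add_divide_distrib)
  show ?thesis unfolding string_op_def 1 2 3 by (simp add: vec_eq_iff algebra_simps)
qed

text \<open>The two claims are proved together because the recurrence has order two: the next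
  operator needs both the current and the previous one. After \<open>k\<close> steps the weight is
  \<open>h - 3 k\<close>, which is the argument of \<open>serre_coeff\<close> in
  \<open>string_op_rec\<close> at \<open>m = k + 1\<close>.\<close>

lemma string_up:
  assumes "y \<in> weight h"
  shows "b1 c1 (b2 c2 ((b1 c1 ^^ k) y)) = (b1 c1 ^^ k) (string_op c1 c2 h (int k) y)"
    and "b2 c2 ((b1 c1 ^^ Suc k) y) = (b1 c1 ^^ k) (string_op c1 c2 h (int k + 1) y)"
proof -
  note lin = funpow_linear(1-3)[OF b_lin(1)]
  have "(b1 c1 ^^ k) y \<in> weight (h - 3 * int k) \<and>
    b1 c1 (b2 c2 ((b1 c1 ^^ k) y)) = (b1 c1 ^^ k) (string_op c1 c2 h (int k) y) \<and>
    b2 c2 ((b1 c1 ^^ Suc k) y) = (b1 c1 ^^ k) (string_op c1 c2 h (int k + 1) y)"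
  proof (induction k)
    case 0
    then show ?case using assms by (simp add: string_op_0_1)
  next
    case (Suc k)
    then have w: "(b1 c1 ^^ k) y \<in> weight (h - 3 * int k)" by simp
    have "int (Suc k) + 1 = (int k + 1) + 1" by simp
    then have "(b1 c1 ^^ Suc k) (string_op c1 c2 h (int (Suc k) + 1) y) = b2 c2 ((b1 c1 ^^ Suc (Suc k)) y)"
      using Suc b2_b1_b1[OF w, of c2 c1] by (simp only: string_op_rec lin) (simp add: lin b_linear)
    then show ?case using Suc weight_b1[OF w, of c1] by (simp add: algebra_simps)
  qed
  then show "b1 c1 (b2 c2 ((b1 c1 ^^ k) y)) = (b1 c1 ^^ k) (string_op c1 c2 h (int k) y)"
    and "b2 c2 ((b1 c1 ^^ Suc k) y) = (b1 c1 ^^ k) (string_op c1 c2 h (int k + 1) y)" by simp_all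
qed

text \<open>The factors commute, so a fold over a set of indices is well defined; this allows
  removing and exchanging factors without tracking their order.\<close>

definition tprod :: "complex \<Rightarrow> complex \<Rightarrow> int \<Rightarrow> int set \<Rightarrow> complex ^ 'n \<Rightarrow> complex ^ 'n" where
  "tprod c1 c2 h M y = Finite_Set.fold (string_op c1 c2 h) y M"

lemma string_op_comp_fun_commute: "comp_fun_commute_on UNIV (string_op c1 c2 h)"
  by standard (simp add: fun_eq_iff string_op_commute)

lemma tprod_empty [simp]: "tprod c1 c2 h {} y = y"
  by (simp add: tprod_def)

lemma tprod_insert:
  "finite M \<Longrightarrow> m \<notin> M \<Longrightarrow> tprod c1 c2 h (insert m M) y = string_op c1 c2 h m (tprod c1 c2 h M y)"
  by (simp add: tprod_def comp_fun_commute_on.fold_insert[OF string_op_comp_fun_commute subset_UNIV])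

lemma tprod_linear:
  assumes "finite M"
  shows "tprod c1 c2 h M (x + y) = tprod c1 c2 h M x + tprod c1 c2 h M y"
    "tprod c1 c2 h M (a *s x) = a *s tprod c1 c2 h M x" "tprod c1 c2 h M 0 = 0"
    "tprod c1 c2 h M (string_op c1 c2 h m x) = string_op c1 c2 h m (tprod c1 c2 h M x)"
    "x \<in> weight k \<Longrightarrow> tprod c1 c2 h M x \<in> weight k"
  using assms by (induction M) (simp_all add: tprod_insert string_op_linear string_op_weight string_op_commute)

lemma tprod_Un:
  assumes "finite M" "finite N" "M \<inter> N = {}"
  shows "tprod c1 c2 h (M \<union> N) y = tprod c1 c2 h M (tprod c1 c2 h N y)"
  using assms(1,3) by (induction M) (use assms(2) in \<open>simp_all add: tprod_insert\<close>)

lemma string_up_prod: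
  assumes "y \<in> weight h"
  shows "(b2 c2 ^^ k) ((b1 c1 ^^ k) y) = tprod c1 c2 h {1..int k} y"
  using assms
proof (induction k arbitrary: y)
  case (Suc k)
  have "{1..int (Suc k)} = insert (int k + 1) {1..int k}" by auto
  then have "tprod c1 c2 h {1..int (Suc k)} y = tprod c1 c2 h {1..int k} (string_op c1 c2 h (int k + 1) y)"
    by (simp add: tprod_insert tprod_linear)
  also have "\<dots> = (b2 c2 ^^ k) ((b1 c1 ^^ k) (string_op c1 c2 h (int k + 1) y))"
    using Suc.IH[OF string_op_weight[OF Suc.prems]] by simp
  also have "\<dots> = (b2 c2 ^^ Suc k) ((b1 c1 ^^ Suc k) y)"
    using string_up(2)[OF Suc.prems, where k=k] by (simp add: funpow_swap1)
  finally show ?case by simp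
qed simp

text \<open>Induction from \<open>y\<close> to \<open>b1 c1 y\<close>: the Serre-type relation
  expresses \<open>b1 b1 b2 y\<close> through terms that the induction hypothesis covers. It makes
  the nilpotency of \<open>b1\<close> on the highest weight vector pass to its components.\<close>

lemma b1_kernel:
  assumes "y \<in> weight k" "(b1 c1 ^^ n) y = 0"
  shows "(b1 c1 ^^ n) (b1 c1 (b2 c2 y)) = 0 \<and> (b1 c1 ^^ n) (b2 c2 (b1 c1 y)) = 0"
  using assms
proof (induction n arbitrary: k y)
  case 0
  then show ?case by (simp add: b_linear)
next
  case (Suc n)
  note lin = funpow_linear(1-3)[OF b_lin(1)]
  have z: "(b1 c1 ^^ n) (b1 c1 y) = 0" using Suc.prems by (simp add: funpow_swap1)
  note IH = Suc.IH[OF weight_b1[OF Suc.prems(1)] z]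
  have "b1 c1 (b1 c1 (b2 c2 y)) = (q + inverse q) *s b1 c1 (b2 c2 (b1 c1 y)) - b2 c2 (b1 c1 (b1 c1 y))
      + serre_coeff c1 c2 k *s b1 c1 y"
    using b2_b1_b1[OF Suc.prems(1), of c2 c1] by (simp add: b_linear)
  then show ?case using IH z by (simp add: funpow_Suc_right lin del: funpow.simps)
qed

lemma b1_kernel_string_op:
  assumes "y \<in> weight k" "(b1 c1 ^^ n) y = 0"
  shows "(b1 c1 ^^ n) (string_op c1 c2 h m y) = 0"
proof -
  note lin = funpow_linear(1-3)[OF b_lin(1)]
  show ?thesis using b1_kernel[OF assms] assms(2) by (simp add: string_op_def lin)
qed

lemma swap_weight: "uq_module.weight q k2 m1 (- k) = weight k"
proof -
  have "(bM y = inverse (q powi k) *s y) = (bK y = q powi k *s y)" for y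
  proof
    assume "bM y = inverse (q powi k) *s y"
    then have "y = inverse (q powi k) *s bK y" by (metis b_inverse(1) b_linear(11))
    then have "q powi k *s y = (q powi k * inverse (q powi k)) *s bK y" by (metis vec.scale_scale)
    then show "bK y = q powi k *s y" using powi_simps(5)[of k] by (simp add: right_inverse)
  qed (use weight_bM[of y k] in \<open>simp add: weight_def\<close>)
  then show ?thesis
    by (simp add: uq_module.weight_def[OF swap] weight_def swap_defs powi_simps)
qed

text \<open>The symmetry exchanges \<open>b1 b2\<close> (index 0) with \<open>b2 b1\<close> (index
  1), hence reflects the index about 1/2, while the weight changes sign.\<close>

lemma swap_string_op: "uq_module.string_op q e2 e1 f2 f1 m2 m1 c2 c1 (- h) m = string_op c1 c2 h (1 - m)"
proof -
  have "string_offset c2 c1 (- h) n = string_offset c1 c2 h (1 - n)" for n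
    by (simp add: string_offset_def algebra_simps)
  moreover have "qint (1 - m) = - qint (m - 1)" "qint (1 - m - 1) = - qint m"
    using qint_simps(3)[of "m - 1"] qint_simps(3)[of m] by simp_all
  ultimately show ?thesis
    by (intro ext, unfold uq_module.string_op_def[OF swap] swap_defs string_op_def)
      (simp add: vec_eq_iff algebra_simps)
qed

lemma string_down:
  assumes "y \<in> weight h"
  shows "b2 c2 (b1 c1 ((b2 c2 ^^ k) y)) = (b2 c2 ^^ k) (string_op c1 c2 h (1 - int k) y)"
    and "b1 c1 ((b2 c2 ^^ Suc k) y) = (b2 c2 ^^ k) (string_op c1 c2 h (- int k) y)"
  using uq_module.string_up(1)[OF swap, of y "- h" c2 c1 k] uq_module.string_up(2)[OF swap, of y "- h" c1 k c2] assms
  by (simp_all add: swap_weight swap_defs swap_string_op)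

lemma b2_kernel_string_op:
  assumes "y \<in> weight k" "(b2 c2 ^^ n) y = 0"
  shows "(b2 c2 ^^ n) (string_op c1 c2 h m y) = 0"
  using uq_module.b1_kernel_string_op[OF swap, of y "- k" n c2 c1 "- h" "1 - m"] assms
  by (simp add: swap_weight swap_defs swap_string_op)

lemma string_down_prod:
  assumes "y \<in> weight h"
  shows "(b1 c1 ^^ k) ((b2 c2 ^^ k) y) = tprod c1 c2 h {1 - int k..0} y"
  using assms
proof (induction k arbitrary: y)
  case (Suc k)
  have "{1 - int (Suc k)..0} = insert (- int k) {1 - int k..0}" by auto
  then have "tprod c1 c2 h {1 - int (Suc k)..0} y = tprod c1 c2 h {1 - int k..0} (string_op c1 c2 h (- int k) y)"
    by (simp add: tprod_insert tprod_linear)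
  also have "\<dots> = (b1 c1 ^^ k) ((b2 c2 ^^ k) (string_op c1 c2 h (- int k) y))"
    using Suc.IH[OF string_op_weight[OF Suc.prems]] by simp
  also have "\<dots> = (b1 c1 ^^ Suc k) ((b2 c2 ^^ Suc k) y)"
    using string_down(2)[OF Suc.prems, where k=k] by (simp add: funpow_swap1)
  finally show ?case by simp
qed simp

end

section \<open>Joint eigenvectors and interpolation\<close>

text \<open>For each \<open>s\<close> some operator separates \<open>s\<close> from the new index
  \<open>r\<close>; subtracting its eigenvalue at \<open>r\<close> kills that summand and only
  rescales the others. Indexing by \<open>p\<close> allows vectors that are zero or
  coincide.\<close>

lemma joint_eigenvectors_sum_zero:
  fixes y :: "'i \<Rightarrow> complex ^ 'n::finite" and T :: "'o \<Rightarrow> complex ^ 'n \<Rightarrow> complex ^ 'n"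
  assumes "finite P" and "\<And>A. A \<in> As \<Longrightarrow> Vector_Spaces.linear (*s) (*s) (T A)"
    and "\<And>A p. A \<in> As \<Longrightarrow> p \<in> P \<Longrightarrow> T A (y p) = ev A p *s y p"
    and "\<And>p p'. p \<in> P \<Longrightarrow> p' \<in> P \<Longrightarrow> p \<noteq> p' \<Longrightarrow> \<exists>A\<in>As. ev A p \<noteq> ev A p'"
    and "(\<Sum>p\<in>P. y p) = 0" and "p \<in> P"
  shows "y p = 0"
  using assms(1,3-)
proof (induction P arbitrary: y p)
  case (insert r P)
  have zero: "y s = 0" if s: "s \<in> P" for s
  proof -
    obtain A where A: "A \<in> As" "ev A s \<noteq> ev A r" using insert.prems(2)[of s r] insert.hyps s by auto
    have "(\<Sum>p\<in>P. (ev A p - ev A r) *s y p) = (\<Sum>p\<in>insert r P. (ev A p - ev A r) *s y p)"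
      using insert.hyps by simp
    also have "\<dots> = T A (\<Sum>p\<in>insert r P. y p) - ev A r *s (\<Sum>p\<in>insert r P. y p)"
      unfolding vec.linear_sum[OF assms(2)[OF A(1)]] vec.scale_sum_right sum_subtractf[symmetric]
      by (rule sum.cong) (simp_all only: insert.prems(1)[OF A(1)] vec.scale_left_diff_distrib)
    also have "\<dots> = 0" using insert.prems(3) lin_simps(4)[OF assms(2)[OF A(1)]] by (simp only:) simp
    finally have sum: "(\<Sum>p\<in>P. (ev A p - ev A r) *s y p) = 0" .
    have "T B ((ev A p - ev A r) *s y p) = ev B p *s ((ev A p - ev A r) *s y p)" if "B \<in> As" "p \<in> P" for B p
      using that insert.prems(1)[OF that(1), of p]
      by (simp only: lin_simps(3)[OF assms(2)[OF that(1)]]) (simp add: vec_eq_iff algebra_simps)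
    then have "(ev A s - ev A r) *s y s = 0"
      using insert.prems(2) s sum by (intro insert.IH[where y = "\<lambda>p. (ev A p - ev A r) *s y p"]) auto
    then show ?thesis using A(2) by (simp add: vec_eq_iff)
  qed
  then have "y r = 0" using insert.prems(3) insert.hyps by simp
  then show ?case using zero insert.prems(4) by auto
qed simp

text \<open>Induction on the number of vectors used: \<open>A - ev a\<close> removes one vector and
  multiplies \<open>y\<close> by a nonzero scalar. Vectors of \<open>X\<close> may share an
  eigenvalue, as happens for \<open>height_above\<close>.\<close>

lemma eigenvector_in_span_others:
  fixes y :: "complex ^ 'n::finite"
  assumes lin: "Vector_Spaces.linear (*s) (*s) A" and y: "A y = \<mu> *s y"
    and X: "\<And>x. x \<in> X \<Longrightarrow> \<exists>l. l \<noteq> \<mu> \<and> A x = l *s x" and "y \<in> vec.span X"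
  shows "y = 0"
proof -
  obtain t r where t: "finite t" "t \<subseteq> X" "y = (\<Sum>a\<in>t. r a *s a)"
    using assms(4) by (auto simp: vec.span_explicit)
  have "y = 0" if "finite t" "t \<subseteq> X" "y = (\<Sum>a\<in>t. r a *s a)" for t r
    using that
  proof (induction t arbitrary: r)
    case (insert a t)
    obtain ev where ev: "\<And>x. x \<in> X \<Longrightarrow> ev x \<noteq> \<mu> \<and> A x = ev x *s x" using X by metis
    let ?s = "\<lambda>x. inverse (\<mu> - ev a) * (ev x - ev a) * r x"
    have "(\<mu> - ev a) *s y = A y - ev a *s y" by (simp add: y vec.scale_left_diff_distrib)
    also have "\<dots> = (\<Sum>x\<in>insert a t. ((ev x - ev a) * r x) *s x)"
      unfolding insert.prems(2) vec.linear_sum[OF lin] vec.scale_sum_right sum_subtractf[symmetric]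
    proof (rule sum.cong)
      fix x assume "x \<in> insert a t"
      then have "A x = ev x *s x" using ev insert.prems(1) by blast
      then show "A (r x *s x) - ev a *s (r x *s x) = ((ev x - ev a) * r x) *s x"
        by (simp only: lin_simps[OF lin]) (simp add: vec_eq_iff algebra_simps)
    qed simp
    also have "\<dots> = (\<Sum>x\<in>t. ((ev x - ev a) * r x) *s x)" using insert.hyps by simp
    finally have scaled: "(\<mu> - ev a) *s y = (\<Sum>x\<in>t. ((ev x - ev a) * r x) *s x)" .
    have "ev a \<noteq> \<mu>" using ev insert.prems(1) by auto
    then have "y = inverse (\<mu> - ev a) *s ((\<mu> - ev a) *s y)" by (simp only: vec.scale_scale) simp
    also have "\<dots> = (\<Sum>x\<in>t. ?s x *s x)"
      unfolding scaled by (simp add: vec.scale_sum_right mult.assoc)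
    finally show ?case using insert.prems(1) by (intro insert.IH[of ?s]) auto
  qed simp
  then show ?thesis using t by blast
qed

text \<open>Finite dimension enters here: infinitely many nonzero eigenvectors with distinct
  eigenvalues would be independent.\<close>

lemma eigenvector_sequence_terminates:
  fixes y :: "nat \<Rightarrow> complex ^ 'n::finite"
  assumes lin: "Vector_Spaces.linear (*s) (*s) A" and "\<And>k. A (y k) = \<mu> k *s y k" and "inj \<mu>"
  shows "\<exists>k. y k = 0"
proof (rule ccontr)
  assume nz: "\<nexists>k. y k = 0"
  have inj: "inj y"
  proof (rule injI)
    fix i j assume "y i = y j"
    then have "\<mu> i *s y i = \<mu> j *s y i" using assms(2)[of i] assms(2)[of j] by metis
    then have "\<mu> i = \<mu> j" using nz vec.scale_cancel_right by blast
    then show "i = j" using assms(3) by (auto dest: injD)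
  qed
  have "vec.independent (range y)"
    unfolding vec.dependent_def
  proof
    assume "\<exists>a\<in>range y. a \<in> vec.span (range y - {a})"
    then obtain i where i: "y i \<in> vec.span (range y - {y i})" by blast
    have "y i = 0"
    proof (rule eigenvector_in_span_others[OF lin assms(2) _ i])
      fix x assume "x \<in> range y - {y i}"
      then show "\<exists>l. l \<noteq> \<mu> i \<and> A x = l *s x" using assms(2,3) by (auto dest: injD)
    qed
    then show False using nz by blast
  qed
  then have "finite (range y)" by (rule vec.finiteI_independent)
  then show False using finite_imageD[OF _ inj] by simp
qed

context uq_module begin

lemma tprod_zero:
  assumes "finite M" "m \<in> M" "string_op c1 c2 h m y = 0"
  shows "tprod c1 c2 h M y = 0"
proof -
  have "M = insert m (M - {m})" using assms(2) by auto
  then have "tprod c1 c2 h M y = string_op c1 c2 h m (tprod c1 c2 h (M - {m}) y)"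
    using assms(1) by (metis Diff_iff finite_Diff insertI1 tprod_insert)
  then show ?thesis using assms by (simp add: tprod_linear(4)[symmetric] tprod_linear(3))
qed

lemma string_op_joint_kernel:
  assumes "a \<noteq> b" "string_op c1 c2 h a y = 0" "string_op c1 c2 h b y = 0"
  shows "string_op c1 c2 h m y = string_ev c1 c2 h a b m *s y"
  using string_op_three_term[OF assms(1), of c1 c2 h m y] assms(2,3) by simp

lemma string_op_sum: "string_op c1 c2 h m (\<Sum>x\<in>X. g x) = (\<Sum>x\<in>X. string_op c1 c2 h m (g x))"
  by (induction X rule: infinite_finite_induct) (simp_all add: string_op_linear)

lemma tprod_sum: "finite M \<Longrightarrow> tprod c1 c2 h M (\<Sum>x\<in>X. g x) = (\<Sum>x\<in>X. tprod c1 c2 h M (g x))"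
  by (induction X rule: infinite_finite_induct) (simp_all add: tprod_linear)

text \<open>Lagrange interpolation inside the kernel of the \<open>a\<close>-th operator. The
  \<open>b\<close>-th operator sends \<open>y\<close> to a sum over the smaller set on whose
  summands it is an invertible scalar; subtracting the preimages leaves a remainder in the joint
  kernel of \<open>a\<close> and \<open>b\<close>.\<close>

lemma interpolation_line:
  assumes Y: "vec.subspace Y" "\<And>m y. y \<in> Y \<Longrightarrow> string_op c1 c2 h m y \<in> Y"
    and "finite B" "a \<notin> B" and "\<And>b m. b \<in> B \<Longrightarrow> m \<in> B \<Longrightarrow> m \<noteq> b \<Longrightarrow> string_ev c1 c2 h a b m \<noteq> 0"
    and "y \<in> Y" "string_op c1 c2 h a y = 0" "tprod c1 c2 h B y = 0"
  shows "\<exists>e. (\<forall>b\<in>B. e b \<in> Y \<and> string_op c1 c2 h a (e b) = 0 \<and> string_op c1 c2 h b (e b) = 0) \<and> y = (\<Sum>b\<in>B. e b)"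
  using assms(3-)
proof (induction B arbitrary: y)
  case (insert b B)
  let ?z = "string_op c1 c2 h b y"
  have "string_op c1 c2 h a ?z = 0" using insert.prems by (simp add: string_op_commute[of _ _ _ a b] string_op_linear)
  moreover have "tprod c1 c2 h B ?z = 0" using insert by (simp add: tprod_insert tprod_linear)
  ultimately obtain e where e: "\<And>c. c \<in> B \<Longrightarrow> e c \<in> Y \<and> string_op c1 c2 h a (e c) = 0 \<and> string_op c1 c2 h c (e c) = 0"
      and z: "?z = (\<Sum>c\<in>B. e c)"
    using insert.IH[of ?z] insert.prems Y(2) by (metis insertCI)
  define e' where "e' c = inverse (string_ev c1 c2 h a c b) *s e c" for c
  define w where "w = y - (\<Sum>c\<in>B. e' c)"
  have e': "e' c \<in> Y" "string_op c1 c2 h a (e' c) = 0" "string_op c1 c2 h c (e' c) = 0" "string_op c1 c2 h b (e' c) = e c"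
    if "c \<in> B" for c
  proof -
    have "a \<noteq> c" "string_ev c1 c2 h a c b \<noteq> 0" using that insert.prems(1) insert.prems(2)[of c b] insert.hyps by auto
    moreover have "string_op c1 c2 h b (e c) = string_ev c1 c2 h a c b *s e c"
      using string_op_joint_kernel[OF \<open>a \<noteq> c\<close>] e[OF that] by blast
    ultimately show "e' c \<in> Y" "string_op c1 c2 h a (e' c) = 0" "string_op c1 c2 h c (e' c) = 0" "string_op c1 c2 h b (e' c) = e c"
      using e[OF that] vec.subspace_scale[OF Y(1)] by (simp_all add: e'_def string_op_linear)
  qed
  have "string_op c1 c2 h b w = 0" using z e' by (simp add: w_def string_op_linear string_op_sum)
  moreover have "string_op c1 c2 h a w = 0" using insert.prems e' by (simp add: w_def string_op_linear string_op_sum)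
  moreover have "w \<in> Y" unfolding w_def
    using insert.prems e' by (intro vec.subspace_diff[OF Y(1)] vec.subspace_sum[OF Y(1)]) auto
  moreover have "y = (\<Sum>c\<in>insert b B. if c = b then w else e' c)"
    using insert.hyps by (simp add: w_def) (smt (verit) sum.cong)
  ultimately show ?case using e' by (intro exI[of _ "\<lambda>c. if c = b then w else e' c"]) auto
qed simp

text \<open>The same elimination, now over the indices in \<open>A\<close>. The subspace
  \<open>Y\<close> carries further conditions on \<open>y\<close> over to every component.\<close>

lemma interpolation:
  assumes Y: "vec.subspace Y" "\<And>m y. y \<in> Y \<Longrightarrow> string_op c1 c2 h m y \<in> Y"
    and B: "finite B" and "finite A" "A \<inter> B = {}"
    and "\<And>a b m. a \<in> A \<Longrightarrow> b \<in> B \<Longrightarrow> m \<in> A \<union> B \<Longrightarrow> m \<noteq> a \<Longrightarrow> m \<noteq> b \<Longrightarrow> string_ev c1 c2 h a b m \<noteq> 0"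
    and "y \<in> Y" "tprod c1 c2 h A y = 0" "tprod c1 c2 h B y = 0"
  shows "\<exists>e. (\<forall>a\<in>A. \<forall>b\<in>B. e a b \<in> Y \<and> string_op c1 c2 h a (e a b) = 0 \<and> string_op c1 c2 h b (e a b) = 0)
    \<and> y = (\<Sum>a\<in>A. \<Sum>b\<in>B. e a b)"
  using assms(4-)
proof (induction A arbitrary: y)
  case (insert a A)
  let ?z = "string_op c1 c2 h a y"
  have "tprod c1 c2 h B ?z = 0" using insert.prems B by (simp add: tprod_linear string_op_linear)
  moreover have "tprod c1 c2 h A ?z = 0" using insert by (simp add: tprod_insert tprod_linear)
  moreover have "A \<inter> B = {}" "?z \<in> Y" using insert.prems Y(2) by auto
  moreover have "string_ev c1 c2 h c b m \<noteq> 0" if "c \<in> A" "b \<in> B" "m \<in> A \<union> B" "m \<noteq> c" "m \<noteq> b" for c b m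
    using insert.prems(2)[of c b m] that by auto
  ultimately obtain e where e: "\<And>c b. c \<in> A \<Longrightarrow> b \<in> B \<Longrightarrow>
        e c b \<in> Y \<and> string_op c1 c2 h c (e c b) = 0 \<and> string_op c1 c2 h b (e c b) = 0"
      and z: "?z = (\<Sum>c\<in>A. \<Sum>b\<in>B. e c b)"
    using insert.IH[of ?z] by blast
  define e' where "e' c b = inverse (string_ev c1 c2 h c b a) *s e c b" for c b
  define w where "w = y - (\<Sum>c\<in>A. \<Sum>b\<in>B. e' c b)"
  have e': "e' c b \<in> Y" "string_op c1 c2 h c (e' c b) = 0" "string_op c1 c2 h b (e' c b) = 0" "string_op c1 c2 h a (e' c b) = e c b"
    if "c \<in> A" "b \<in> B" for c b
  proof -
    have "c \<noteq> b" "string_ev c1 c2 h c b a \<noteq> 0" using that insert.prems(1) insert.prems(2)[of c b a] insert.hyps by auto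
    moreover have "string_op c1 c2 h a (e c b) = string_ev c1 c2 h c b a *s e c b"
      using string_op_joint_kernel[OF \<open>c \<noteq> b\<close>] e[OF that] by blast
    ultimately show "e' c b \<in> Y" "string_op c1 c2 h c (e' c b) = 0" "string_op c1 c2 h b (e' c b) = 0" "string_op c1 c2 h a (e' c b) = e c b"
      using e[OF that] vec.subspace_scale[OF Y(1)] by (simp_all add: e'_def string_op_linear)
  qed
  have w: "string_op c1 c2 h a w = 0" using z e' by (simp add: w_def string_op_linear string_op_sum)
  have "tprod c1 c2 h B (e' c b) = 0" if "c \<in> A" "b \<in> B" for c b
    using tprod_zero[OF B that(2)] e' that by blast
  then have "tprod c1 c2 h B (\<Sum>c\<in>A. \<Sum>b\<in>B. e' c b) = 0" using B by (simp add: tprod_sum)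
  moreover have "y = w + (\<Sum>c\<in>A. \<Sum>b\<in>B. e' c b)" by (simp add: w_def)
  ultimately have wB: "tprod c1 c2 h B w = 0" using insert.prems(5) B by (metis add.right_neutral tprod_linear(1))
  have wY: "w \<in> Y" unfolding w_def
    using insert.prems e' by (intro vec.subspace_diff[OF Y(1)] vec.subspace_sum[OF Y(1)]) auto
  \<comment> \<open>The remainder \<open>w\<close> is killed by the \<open>a\<close>-th operator and
    by the product over \<open>B\<close>, so it contributes the row of \<open>a\<close>.\<close>
  obtain g where g: "\<And>b. b \<in> B \<Longrightarrow> g b \<in> Y \<and> string_op c1 c2 h a (g b) = 0 \<and> string_op c1 c2 h b (g b) = 0"
      "w = (\<Sum>b\<in>B. g b)"
  proof -
    have "a \<notin> B" using insert.prems(1) by auto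
    moreover have "string_ev c1 c2 h a b m \<noteq> 0" if "b \<in> B" "m \<in> B" "m \<noteq> b" for b m
      using insert.prems(2)[of a b m] that \<open>a \<notin> B\<close> by auto
    ultimately show ?thesis using interpolation_line[OF Y B _ _ wY w wB] that by blast
  qed
  have "y = (\<Sum>c\<in>insert a A. \<Sum>b\<in>B. if c = a then g b else e' c b)"
    using insert.hyps g(2) by (simp add: w_def) (smt (verit) sum.cong diff_eq_eq add.commute)
  then show ?case using e' g by (intro exI[of _ "\<lambda>c b. if c = a then g b else e' c b"]) auto
qed simp

end

section \<open>Highest weight strings and leading terms\<close>

context uq_module begin

text \<open>The induction step for the coefficient of E F^(k+1) on a highest weight vector of a
  quantum sl2.\<close>

lemma qint_product: "qint k * qint (a - k + 1) + qint (a - 2 * k) = qint (k + 1) * qint (a - k)"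
  using qint_three_term[of "a - k + 1" "a - 2 * k" "a - k"] by (simp add: algebra_simps)

lemma m_eigen: "k1 y = q powi a *s y \<Longrightarrow> m1 y = inverse (q powi a) *s y"
  "k2 y = q powi a *s y \<Longrightarrow> m2 y = inverse (q powi a) *s y"
proof -
  have *: "z = inverse c *s y" if "y = c *s z" "c \<noteq> 0" for c and z :: "complex ^ 'n"
    using that by (simp add: vec_eq_iff)
  show "m1 y = inverse (q powi a) *s y" if "k1 y = q powi a *s y"
    using arg_cong[OF that, of m1] powi_simps(5) by (intro *) (simp_all add: km linear_simps)
  show "m2 y = inverse (q powi a) *s y" if "k2 y = q powi a *s y"
    using arg_cong[OF that, of m2] powi_simps(5) by (intro *) (simp_all add: km linear_simps)
qed

lemma k1_m1_diff:
  assumes "k1 y = q powi a *s y"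
  shows "(1 / (q - inverse q)) *s (k1 y - m1 y) = qint a *s y"
  unfolding m_eigen(1)[OF assms] unfolding assms qint_def
  by (simp add: vec_eq_iff diff_divide_distrib algebra_simps)

lemma f1_string:
  assumes "e1 y = 0" "k1 y = q powi a *s y"
  shows "k1 ((f1 ^^ k) y) = q powi (a - 2 * int k) *s (f1 ^^ k) y"
    and "e1 ((f1 ^^ Suc k) y) = (qint (int k + 1) * qint (a - int k)) *s (f1 ^^ k) y"
proof -
  show weight: "k1 ((f1 ^^ k) y) = q powi (a - 2 * int k) *s (f1 ^^ k) y" for k
  proof (induction k)
    case (Suc k)
    have "q powi (a - 2 * int (Suc k)) = inverse q ^ 2 * q powi (a - 2 * int k)"
      by (simp add: powi_simps power_mult_distrib power_inverse field_simps)
    then show ?case using Suc by (simp add: kf linear_simps)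
  qed (simp add: assms)
  show "e1 ((f1 ^^ Suc k) y) = (qint (int k + 1) * qint (a - int k)) *s (f1 ^^ k) y"
  proof (induction k)
    case 0
    then show ?case using k1_m1_diff[OF assms(2)] by (simp add: ef assms(1) linear_simps)
  next
    case (Suc k)
    let ?z = "(f1 ^^ Suc k) y"
    have "e1 (f1 ?z) = f1 (e1 ?z) + (1 / (q - inverse q)) *s (k1 ?z - m1 ?z)" by (rule ef)
    also have "(1 / (q - inverse q)) *s (k1 ?z - m1 ?z) = qint (a - 2 * int (Suc k)) *s ?z"
      by (rule k1_m1_diff[OF weight])
    also have "f1 (e1 ?z) = (qint (int (Suc k)) * qint (a - int (Suc k) + 1)) *s ?z"
      using Suc by (simp add: linear_simps add.commute)
    finally show ?case using qint_product[of "int (Suc k)" a]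
      by (simp only: vec.scale_left_distrib[symmetric] funpow.simps comp_apply)
  qed
qed

lemma powi_inject: "q powi m = q powi n \<Longrightarrow> m = n"
proof -
  assume "q powi m = q powi n"
  then have "q powi (m - n) = q powi n * inverse (q powi n)" by (simp only: powi_simps(2))
  also have "\<dots> = 1" by (rule right_inverse[OF powi_simps(5)])
  finally show "m = n" using qroot[of "m - n"] by auto
qed

lemma inj_powi: "inj (\<lambda>k. q powi (a - 2 * int k))"
  by (rule injI) (auto dest: powi_inject)

text \<open>The coefficient \<open>qint (k + 1) * qint (n - k)\<close> vanishes only at
  \<open>k = n\<close>. So the powers up to \<open>n\<close> survive, and the vanishing of some
  power, forced by finite dimension, descends to the power \<open>n + 1\<close>.\<close>

lemma f1_string_length:
  assumes "y \<noteq> 0" "e1 y = 0" "k1 y = q powi int n *s y"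
  shows "k \<le> n \<Longrightarrow> (f1 ^^ k) y \<noteq> 0" and "n < k \<Longrightarrow> (f1 ^^ k) y = 0"
proof -
  note st = f1_string[OF assms(2,3)]
  show nz: "(f1 ^^ k) y \<noteq> 0" if "k \<le> n" for k
    using that
  proof (induction k)
    case (Suc k)
    then have "(qint (int k + 1) * qint (int n - int k)) *s (f1 ^^ k) y \<noteq> 0" by simp
    then show ?case using st(2)[of k] linear_simps by metis
  qed (use assms in simp)
  have "\<exists>k. (f1 ^^ k) y = 0"
    by (rule eigenvector_sequence_terminates[OF lin(5) st(1) inj_powi])
  then obtain N where N: "(f1 ^^ N) y = 0" by blast
  have "(f1 ^^ Suc n) y = 0"
  proof (cases "N \<le> Suc n")
    case True
    then show ?thesis using N nz[of N] by (metis le_SucE)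
  next
    case False
    have "(f1 ^^ Suc n) y = 0 \<longleftrightarrow> (f1 ^^ N) y = 0" if "Suc n \<le> N" for N
      using that
    proof (induction N rule: dec_induct)
      case (step N)
      have "(qint (int N + 1) * qint (int n - int N)) \<noteq> 0" using step by simp
      then have "(f1 ^^ N) y = 0 \<longleftrightarrow> (f1 ^^ Suc N) y = 0"
        using st(2)[of N] by (metis vec.scale_eq_0_iff lin_simps(4)[OF lin(1)] lin_simps(4)[OF lin(3)] funpow.simps(2) comp_apply)
      then show ?case using step.IH by blast
    qed simp
    from this[of N] show ?thesis using N False by (meson nat_le_linear)
  qed
  then show "(f1 ^^ k) y = 0" if "n < k"
  proof -
    have "(f1 ^^ k) y = (f1 ^^ (k - Suc n)) ((f1 ^^ Suc n) y)"
      using that funpow_add[of "k - Suc n" "Suc n" f1] by (simp del: funpow.simps)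
    then show ?thesis using \<open>(f1 ^^ Suc n) y = 0\<close> funpow_linear(3,4)[OF lin(3)] by simp
  qed
qed

lemmas f2_string = uq_module.f1_string[OF swap]
lemmas f2_string_length = uq_module.f1_string_length[OF swap]

text \<open>\<open>k1 k2\<close> scales under \<open>e1\<close>, \<open>e2\<close> by
  \<open>q\<close> and under \<open>f1\<close>, \<open>f2\<close> by \<open>q^-1\<close>. In
  \<open>b1\<close> and \<open>b2\<close> the \<open>f\<close> part thus lowers the height by one
  while the \<open>e\<close> part raises it, so setting \<open>c1 = c2 = 0\<close> picks out the
  lowest part.\<close>

definition height :: "int \<Rightarrow> (complex ^ 'n) set" where "height j = {y. k1 (k2 y) = q powi j *s y}"
definition height_above :: "int \<Rightarrow> (complex ^ 'n) set" where "height_above j = vec.span (\<Union>i\<in>{j<..}. height i)"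

lemma height_closed: "x \<in> height j \<Longrightarrow> y \<in> height j \<Longrightarrow> x + y \<in> height j" "x \<in> height j \<Longrightarrow> y \<in> height j \<Longrightarrow> x - y \<in> height j"
  "x \<in> height j \<Longrightarrow> a *s x \<in> height j"
  by (auto simp: height_def linear_simps vec_eq_iff algebra_simps)

lemma height_ops: "y \<in> height j \<Longrightarrow> e1 y \<in> height (j + 1)" "y \<in> height j \<Longrightarrow> e2 y \<in> height (j + 1)"
  "y \<in> height j \<Longrightarrow> f1 y \<in> height (j - 1)" "y \<in> height j \<Longrightarrow> f2 y \<in> height (j - 1)"
  "y \<in> height j \<Longrightarrow> m1 y \<in> height j" "y \<in> height j \<Longrightarrow> m2 y \<in> height j"
proof -
  have k: "q powi (j + 1) = q * q powi j" "q powi (j - 1) = inverse q * q powi j"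
    by (simp_all add: powi_simps)
  show "y \<in> height j \<Longrightarrow> e1 y \<in> height (j + 1)" "y \<in> height j \<Longrightarrow> e2 y \<in> height (j + 1)"
  "y \<in> height j \<Longrightarrow> f1 y \<in> height (j - 1)" "y \<in> height j \<Longrightarrow> f2 y \<in> height (j - 1)"
    using q0 by (simp_all add: height_def ke kf linear_simps k power2_eq_square mult.assoc[symmetric])
  have "k1 (k2 (m1 y)) = m1 (k1 (k2 y))" "k1 (k2 (m2 y)) = m2 (k1 (k2 y))"
    by (simp_all add: kk km)
  then show "y \<in> height j \<Longrightarrow> m1 y \<in> height j" "y \<in> height j \<Longrightarrow> m2 y \<in> height j"
    by (simp_all add: height_def linear_simps)
qed

lemma height_aboveI: "y \<in> height i \<Longrightarrow> j < i \<Longrightarrow> y \<in> height_above j"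
  unfolding height_above_def by (rule vec.span_base) auto

lemma height_above_closed: "x \<in> height_above j \<Longrightarrow> y \<in> height_above j \<Longrightarrow> x + y \<in> height_above j"
  "x \<in> height_above j \<Longrightarrow> y \<in> height_above j \<Longrightarrow> x - y \<in> height_above j" "x \<in> height_above j \<Longrightarrow> a *s x \<in> height_above j"
  "0 \<in> height_above j"
  unfolding height_above_def by (auto intro: vec.span_add vec.span_diff vec.span_scale vec.span_zero)

lemma height_above_disjoint:
  assumes "y \<in> height j" "y \<in> height_above j" shows "y = 0"
proof -
  have "Vector_Spaces.linear (*s) (*s) (\<lambda>y. k1 (k2 y))"
    using Vector_Spaces.linear_compose[OF lin(6) lin(5)] by (simp add: comp_def)
  then show ?thesis
  proof (rule eigenvector_in_span_others)
    show "k1 (k2 y) = q powi j *s y" using assms(1) by (simp add: height_def)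
    show "y \<in> vec.span (\<Union>i\<in>{j<..}. height i)" using assms(2) by (simp add: height_above_def)
    fix x assume "x \<in> (\<Union>i\<in>{j<..}. height i)"
    then obtain i where i: "j < i" "x \<in> height i" by auto
    have "q powi i \<noteq> q powi j"
      using powi_inject i(1) by auto
    then show "\<exists>l. l \<noteq> q powi j \<and> k1 (k2 x) = l *s x" using i(2) by (auto simp: height_def)
  qed
qed

lemma b_0: "b1 0 = f1" "b2 0 = f2" by (simp_all add: fun_eq_iff b1_def b2_def)

text \<open>The products of \<open>f1\<close> and \<open>f2\<close> lower the height by 2; every
  other term is a multiple of \<open>y\<close> or contains an \<open>e\<close>, and ends at height
  \<open>j\<close> or \<open>j + 2\<close>.\<close>

lemma string_op_leading:
  assumes "y \<in> height j"
  shows "string_op 0 0 h m y \<in> height (j - 2)" "string_op c1 c2 h m y - string_op 0 0 h m y \<in> height_above (j - 2)"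
proof -
  have F: "f1 (f2 y) \<in> height (j - 2)" "f2 (f1 y) \<in> height (j - 2)"
    using height_ops(3)[OF height_ops(4)[OF assms]] height_ops(4)[OF height_ops(3)[OF assms]] by simp_all
  have rr0: "string_offset 0 0 h m = 0" for m by (simp add: string_offset_def)
  show "string_op 0 0 h m y \<in> height (j - 2)"
    using F by (simp add: string_op_def b_0 rr0 height_closed)
  have up: "x \<in> height i \<Longrightarrow> j \<le> i \<Longrightarrow> x \<in> height_above (j - 2)" for x i by (rule height_aboveI) auto
  have terms: "f1 (e1 (m2 y)) \<in> height j" "e2 (m1 (f2 y)) \<in> height j" "e2 (m1 (e1 (m2 y))) \<in> height (j + 2)"
     "f2 (e2 (m1 y)) \<in> height j" "e1 (m2 (f1 y)) \<in> height j" "e1 (m2 (e2 (m1 y))) \<in> height (j + 2)"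
    using height_ops(3)[OF height_ops(1)[OF height_ops(6)[OF assms]]] height_ops(2)[OF height_ops(5)[OF height_ops(4)[OF assms]]]
      height_ops(2)[OF height_ops(5)[OF height_ops(1)[OF height_ops(6)[OF assms]]]]
      height_ops(4)[OF height_ops(2)[OF height_ops(5)[OF assms]]] height_ops(1)[OF height_ops(6)[OF height_ops(3)[OF assms]]]
      height_ops(1)[OF height_ops(6)[OF height_ops(2)[OF height_ops(5)[OF assms]]]]
    by (simp_all add: add.assoc)
  note terms' = this[THEN up, simplified] up[OF assms]
  define D1 where "D1 = b1 c1 (b2 c2 y) - f1 (f2 y)"
  define D2 where "D2 = b2 c2 (b1 c1 y) - f2 (f1 y)"
  have "D1 = (c1 * c2) *s e2 (m1 (e1 (m2 y))) - c2 *s f1 (e1 (m2 y)) - c1 *s e2 (m1 (f2 y))"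
    "D2 = (c1 * c2) *s e1 (m2 (e2 (m1 y))) - c1 *s f2 (e2 (m1 y)) - c2 *s e1 (m2 (f1 y))"
    by (simp_all add: D1_def D2_def b1_def b2_def linear_simps vec_eq_iff algebra_simps)
  then have D: "D1 \<in> height_above (j - 2)" "D2 \<in> height_above (j - 2)"
    using terms' by (simp_all add: height_above_closed)
  have "string_op c1 c2 h m y - string_op 0 0 h m y = qint m *s D2 - qint (m - 1) *s D1
      + (string_offset c1 c2 h m - qint m * string_offset c1 c2 h 1 + qint (m - 1) * string_offset c1 c2 h 0) *s y"
    by (simp add: string_op_def b_0 rr0 D1_def D2_def vec_eq_iff algebra_simps)
  also have "\<dots> \<in> height_above (j - 2)" using D terms' by (simp add: height_above_closed)
  finally show "string_op c1 c2 h m y - string_op 0 0 h m y \<in> height_above (j - 2)" .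
qed

lemma string_op_gw_above:
  assumes "y \<in> height_above j" shows "string_op c1 c2 h m y \<in> height_above (j - 2)"
  using assms unfolding height_above_def
proof (induction rule: vec.span_induct_alt)
  case base
  then show ?case by (simp add: string_op_linear vec.span_zero)
next
  case (step c x y)
  then obtain i where i: "j < i" "x \<in> height i" by auto
  have "height_above (i - 2) \<subseteq> height_above (j - 2)"
    unfolding height_above_def using i by (intro vec.span_mono UN_mono) auto
  moreover have "string_op 0 0 h m x \<in> height_above (j - 2)"
    using string_op_leading(1)[OF i(2)] by (rule height_aboveI) (use i in auto)
  moreover have "string_op c1 c2 h m x = (string_op c1 c2 h m x - string_op 0 0 h m x) + string_op 0 0 h m x" by simp
  ultimately have "string_op c1 c2 h m x \<in> height_above (j - 2)"
    using string_op_leading(2)[OF i(2), of c1 c2 h m] height_above_closed(1) by (metis subsetD)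
  then show ?case using step.IH by (simp add: string_op_linear height_above_closed height_above_def[symmetric])
qed

lemma tprod_leading:
  assumes "finite M" "y \<in> height j"
  shows "tprod 0 0 h M y \<in> height (j - 2 * int (card M)) \<and>
    tprod c1 c2 h M y - tprod 0 0 h M y \<in> height_above (j - 2 * int (card M))"
  using assms
proof (induction M)
  case (insert m M)
  let ?j = "j - 2 * int (card M)"
  let ?y = "tprod c1 c2 h M y" and ?z = "tprod 0 0 h M y"
  have j: "j - 2 * int (card (insert m M)) = ?j - 2" using insert by simp
  have IH: "?z \<in> height ?j" "?y - ?z \<in> height_above ?j" using insert by auto
  have "string_op c1 c2 h m ?y - string_op 0 0 h m ?z = string_op c1 c2 h m (?y - ?z) + (string_op c1 c2 h m ?z - string_op 0 0 h m ?z)"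
    by (simp add: string_op_linear)
  also have "\<dots> \<in> height_above (?j - 2)"
    using string_op_gw_above[OF IH(2)] string_op_leading(2)[OF IH(1)] by (rule height_above_closed)
  finally show ?case unfolding j using insert.hyps string_op_leading(1)[OF IH(1)] by (simp add: tprod_insert)
qed (simp_all add: height_above_closed)

end

section \<open>Non-vanishing of the components\<close>

context uq_module begin

lemma tprod_superset:
  assumes "finite M" "N \<subseteq> M" "tprod c1 c2 h N y = 0" shows "tprod c1 c2 h M y = 0"
proof -
  have "M = (M - N) \<union> N" "finite N" using assms finite_subset by auto
  then have "tprod c1 c2 h M y = tprod c1 c2 h (M - N) (tprod c1 c2 h N y)"
    using tprod_Un[of "M - N" N] assms(1) by (metis Diff_disjoint finite_Diff inf_commute)
  then show ?thesis using assms by (simp add: tprod_linear)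
qed

text \<open>For \<open>c1 = c2 = 0\<close> any three of the operators are linearly dependent without a constant term.\<close>
lemma tprod_exchange:
  assumes M: "finite M" "{p, r, s} \<subseteq> M" "r \<noteq> s" "p \<noteq> r" "p \<noteq> s"
    and ps: "tprod 0 0 h (M - {p, s}) y = 0" and pr: "tprod 0 0 h (M - {p, r}) y = 0"
  shows "tprod 0 0 h (M - {r, s}) y = 0"
proof -
  let ?D = "M - {p, r, s}"
  have sets: "M - {p, s} = insert r ?D" "M - {p, r} = insert s ?D" "M - {r, s} = insert p ?D"
    using M by auto
  have D: "finite ?D" "p \<notin> ?D" "r \<notin> ?D" "s \<notin> ?D" using M(1) by auto
  have *: "tprod 0 0 h (M - {p, s}) y = string_op 0 0 h r (tprod 0 0 h ?D y)"
    "tprod 0 0 h (M - {p, r}) y = string_op 0 0 h s (tprod 0 0 h ?D y)"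
    "tprod 0 0 h (M - {r, s}) y = string_op 0 0 h p (tprod 0 0 h ?D y)"
    unfolding sets by (rule tprod_insert[OF D(1)], rule D)+
  have "string_op 0 0 h p (tprod 0 0 h ?D y) = string_ev 0 0 h r s p *s tprod 0 0 h ?D y"
    by (rule string_op_joint_kernel[OF M(3)]) (simp_all only: *(1,2)[symmetric] ps pr)
  then show ?thesis unfolding *(3) by (simp add: string_ev_def)
qed

section \<open>Eigenvalue sequences and positions in a string\<close>

lemma tprod_eigen:
  assumes "finite M" "a \<noteq> b" "string_op c1 c2 h a y = 0" "string_op c1 c2 h b y = 0"
  shows "tprod c1 c2 h M y = (\<Prod>m\<in>M. string_ev c1 c2 h a b m) *s y"
  using assms(1)
  by (induction M) (simp_all add: tprod_insert string_op_linear string_op_joint_kernel[OF assms(2-4)] mult.commute)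

lemma string_ev_rec:
  assumes "a \<noteq> b"
  shows "string_ev c1 c2 h a b (m + 1) = (q + inverse q) * string_ev c1 c2 h a b m - string_ev c1 c2 h a b (m - 1)
    + serre_coeff c1 c2 (h - 3 * (m - 1))"
proof -
  have 1: "qint (m + 1 - b) = (q + inverse q) * qint (m - b) - qint (m - 1 - b)"
    using qint_rec[of "m - b"] by (simp add: algebra_simps)
  have 2: "qint (a - (m + 1)) = (q + inverse q) * qint (a - m) - qint (a - (m - 1))"
    using qint_rec[of "a - m"] by (simp add: algebra_simps)
  show ?thesis
    unfolding string_ev_eq[OF assms] 1 2 string_offset_rec
    by (simp add: add_divide_distrib diff_divide_distrib algebra_simps)
qed

text \<open>Position \<open>m\<close> in a string labelled by \<open>(a, b)\<close>:
  \<open>b1\<close> moves to \<open>m + 1\<close> and \<open>b2\<close> to \<open>m - 1\<close>.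
  Prescribing two consecutive eigenvalues makes the condition stable under these moves, since
  \<open>string_ev_rec\<close> has order two.\<close>

definition string_space :: "complex \<Rightarrow> complex \<Rightarrow> int \<Rightarrow> int \<Rightarrow> int \<Rightarrow> int \<Rightarrow> (complex ^ 'n) set" where
  "string_space c1 c2 h a b m = {y \<in> weight (h - 3 * m). b1 c1 (b2 c2 y) = string_ev c1 c2 h a b m *s y \<and>
     b2 c2 (b1 c1 y) = string_ev c1 c2 h a b (m + 1) *s y}"

lemma string_space_b1:
  assumes "a \<noteq> b" "y \<in> string_space c1 c2 h a b m"
  shows "b1 c1 y \<in> string_space c1 c2 h a b (m + 1)"
proof -
  have y: "y \<in> weight (h - 3 * m)" "b1 c1 (b2 c2 y) = string_ev c1 c2 h a b m *s y"
    "b2 c2 (b1 c1 y) = string_ev c1 c2 h a b (m + 1) *s y" using assms(2) by (simp_all add: string_space_def)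
  have "b2 c2 (b1 c1 (b1 c1 y)) = ((q + inverse q) * string_ev c1 c2 h a b (m + 1) - string_ev c1 c2 h a b m
      + serre_coeff c1 c2 (h - 3 * m)) *s b1 c1 y"
    unfolding b2_b1_b1[OF y(1)] y(2,3) b_linear by (simp add: vec_eq_iff algebra_simps)
  also have "\<dots> = string_ev c1 c2 h a b (m + 1 + 1) *s b1 c1 y"
    using string_ev_rec[OF assms(1), of c1 c2 h "m + 1"] by simp
  finally show ?thesis using weight_b1[OF y(1)] y by (simp add: string_space_def b_linear algebra_simps)
qed

lemma string_space_b2:
  assumes "a \<noteq> b" "y \<in> string_space c1 c2 h a b m"
  shows "b2 c2 y \<in> string_space c1 c2 h a b (m - 1)"
proof -
  have y: "y \<in> weight (h - 3 * m)" "b1 c1 (b2 c2 y) = string_ev c1 c2 h a b m *s y"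
    "b2 c2 (b1 c1 y) = string_ev c1 c2 h a b (m + 1) *s y" using assms(2) by (simp_all add: string_space_def)
  have "b1 c1 (b2 c2 (b2 c2 y)) = ((q + inverse q) * string_ev c1 c2 h a b m - string_ev c1 c2 h a b (m + 1)
      + serre_coeff c1 c2 (h - 3 * m + 3)) *s b2 c2 y"
    unfolding b1_b2_b2[OF y(1)] y(2,3) b_linear by (simp add: vec_eq_iff algebra_simps)
  also have "(q + inverse q) * string_ev c1 c2 h a b m - string_ev c1 c2 h a b (m + 1) + serre_coeff c1 c2 (h - 3 * m + 3) =
      string_ev c1 c2 h a b (m - 1)"
    using string_ev_rec[OF assms(1), of c1 c2 h m] by (simp add: algebra_simps)
  finally show ?thesis using weight_b2[OF y(1)] y by (simp add: string_space_def b_linear algebra_simps)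
qed

lemma string_space_pow:
  assumes "a \<noteq> b" "y \<in> string_space c1 c2 h a b m"
  shows "(b1 c1 ^^ k) y \<in> string_space c1 c2 h a b (m + int k)" "(b2 c2 ^^ k) y \<in> string_space c1 c2 h a b (m - int k)"
proof (induction k)
  case 0
  case 1 show ?case using assms by simp
  case 2 show ?case using assms by simp
next
  case (Suc k)
  case 1 show ?case using string_space_b1[OF assms(1) Suc(1)] by (simp add: algebra_simps)
  case 2 show ?case using string_space_b2[OF assms(1) Suc(2)] by (simp add: algebra_simps)
qed

text \<open>Two joint eigenvalues that agree at consecutive indices agree everywhere, since both solve the
  second-order recurrence of \<open>string_ev_rec\<close>.\<close>
lemma string_ev_determines:
  assumes "a \<noteq> b" "a' \<noteq> b'" "string_ev c1 c2 h a b m = string_ev c1 c2 h a' b' m"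
    "string_ev c1 c2 h a b (m + 1) = string_ev c1 c2 h a' b' (m + 1)"
  shows "string_ev c1 c2 h a b n = string_ev c1 c2 h a' b' n"
proof -
  have up: "string_ev c1 c2 h a b (m + int k) = string_ev c1 c2 h a' b' (m + int k) \<and>
    string_ev c1 c2 h a b (m + int k + 1) = string_ev c1 c2 h a' b' (m + int k + 1)" for k
  proof (induction k)
    case (Suc k)
    have "m + int (Suc k) = m + int k + 1" by simp
    then show ?case
      using string_ev_rec[OF assms(1), of c1 c2 h "m + int k + 1"] string_ev_rec[OF assms(2), of c1 c2 h "m + int k + 1"] Suc
      by (simp only: add_diff_cancel_right')
  qed (use assms in simp)
  have down: "string_ev c1 c2 h a b (m - int k) = string_ev c1 c2 h a' b' (m - int k) \<and>
    string_ev c1 c2 h a b (m - int k + 1) = string_ev c1 c2 h a' b' (m - int k + 1)" for k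
  proof (induction k)
    case (Suc k)
    have "m - int (Suc k) = m - int k - 1" "m - int k - 1 + 1 = m - int k" by simp_all
    moreover have "string_ev c1 c2 h a b (m - int k - 1) = string_ev c1 c2 h a' b' (m - int k - 1)"
    proof -
      have "x = y" if "u = s - x + f" "u = s - y + f" for u s x y f :: complex using that by simp
      from this[OF string_ev_rec[OF assms(1), of c1 c2 h "m - int k"]] show ?thesis
        using string_ev_rec[OF assms(2), of c1 c2 h "m - int k"] Suc by (simp only:)
    qed
    ultimately show ?case using Suc by (simp only:)
  qed (use assms in simp)
  show ?thesis using up[of "nat (n - m)"] down[of "nat (m - n)"] by (cases "m \<le> n") auto
qed

end

text \<open>\<open>generated\<close> is cyclicity of \<open>v\<close>, the form in which
  irreducibility enters; \<open>coideal_generated\<close> sharpens it to cyclicity over the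
  coideal.\<close>

locale uq_hw = uq_module q e1 e2 f1 f2 k1 k2 m1 m2
  for q and e1 e2 f1 f2 k1 k2 m1 m2 :: "complex ^ 'n::finite \<Rightarrow> complex ^ 'n" +
  fixes v :: "complex ^ 'n" and l1 l2 :: nat
  assumes v0: "v \<noteq> 0" and ev: "e1 v = 0" "e2 v = 0"
    and kv: "k1 v = q powi int l1 *s v" "k2 v = q powi int l2 *s v"
    and generated: "vec.subspace U \<Longrightarrow> (\<And>g y. g \<in> {e1, e2, f1, f2, k1, k2, m1, m2} \<Longrightarrow> y \<in> U \<Longrightarrow> g y \<in> U)
      \<Longrightarrow> v \<in> U \<Longrightarrow> U = UNIV"
begin

lemma swap_hw: "uq_hw q e2 e1 f2 f1 k2 k1 m2 m1 v l2 l1"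
proof (intro uq_hw.intro swap uq_hw_axioms.intro)
  fix U assume U: "vec.subspace U" "\<And>g y. g \<in> {e2, e1, f2, f1, k2, k1, m2, m1} \<Longrightarrow> y \<in> U \<Longrightarrow> g y \<in> U" "v \<in> U"
  show "U = UNIV" by (rule generated[OF U(1) _ U(3)]) (use U(2) in blast)
qed (fact v0 ev kv)+

abbreviation h :: int where "h \<equiv> int l1 - int l2"

lemma v_weight: "v \<in> weight h"
  using m_eigen(2)[OF kv(2)] by (simp add: weight_def bK_def linear_simps kv powi_simps mult.commute)

text \<open>\<open>m1\<close> acts on each power as a scalar, and \<open>e2\<close> commutes with
  \<open>f1\<close> and kills \<open>v\<close>; so the \<open>e\<close> part of \<open>b1\<close>
  never contributes.\<close>

lemma b1_pow_v: "(b1 c ^^ k) v = (f1 ^^ k) v \<and> e2 ((f1 ^^ k) v) = 0"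
proof (induction k)
  case (Suc k)
  have "m1 ((f1 ^^ k) v) = inverse (q powi (int l1 - 2 * int k)) *s (f1 ^^ k) v"
    by (rule m_eigen(1)[OF f1_string(1)[OF ev(1) kv(1)]])
  then show ?case using Suc by (simp add: b1_def ef linear_simps)
qed (simp add: ev)

lemma b1_pow_v_zero: "(b1 c ^^ Suc l1) v = 0"
  using b1_pow_v[of "Suc l1" c] f1_string_length(2)[OF v0 ev(1) kv(1), of "Suc l1"] by simp

lemmas b2_pow_v_zero = uq_hw.b1_pow_v_zero[OF swap_hw, unfolded swap_defs]

lemma tprod_v_zero: "tprod c1 c2 h {1..int l1 + 1} v = 0" "tprod c1 c2 h {- int l2..0} v = 0"
proof -
  show "tprod c1 c2 h {1..int l1 + 1} v = 0"
    using string_up_prod[OF v_weight, of "Suc l1" c2 c1] b1_pow_v_zero[of c1] funpow_linear(4)[OF b_lin(2), of "Suc l1"]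
    by (simp add: add.commute del: funpow.simps)
  show "tprod c1 c2 h {- int l2..0} v = 0"
    using string_down_prod[OF v_weight, of "Suc l2" c1 c2] b2_pow_v_zero[of c2] funpow_linear(4)[OF b_lin(1), of "Suc l2"]
    by (simp del: funpow.simps)
qed

text \<open>The vector follows the reduced word s2 s1 s2 of the longest Weyl group element: at each
  stage it is a highest weight vector for the next quantum sl2, and the exponent is exactly the
  length of its string.\<close>

lemma corner_nonzero: "tprod 0 0 h {1 - int l2..int l1} v \<noteq> 0"
proof -
  let ?y = "(f2 ^^ l2) v" and ?N = "l1 + l2"
  have f2w: "e1 ((f2 ^^ k) v) = 0 \<and> k1 ((f2 ^^ k) v) = q powi int (l1 + k) *s (f2 ^^ k) v" for k
    by (induction k) (simp_all add: ev kv ef kf linear_simps powi_simps power_int_add mult.commute del: of_nat_add add: of_nat_add)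
  have y: "?y \<noteq> 0" by (rule f2_string_length(1)[OF v0 ev(2) kv(2) order_refl])
  let ?z = "(f1 ^^ ?N) ?y"
  have z: "?z \<noteq> 0" by (rule f1_string_length(1)[OF y conjunct1[OF f2w] conjunct2[OF f2w] order_refl])
  have comm: "e2 ((f1 ^^ k) x) = (f1 ^^ k) (e2 x)" for k x by (induction k) (simp_all add: ef)
  \<comment> \<open>\<open>e2\<close> moves past the \<open>f1\<close> and turns
    \<open>f2^l2 v\<close> into a multiple of \<open>f2^(l2-1) v\<close>, whose
    \<open>f1\<close>-string has length \<open>l1 + l2 - 1\<close> and is killed by one more
    \<open>f1\<close>.\<close>
  have "e2 ?z = 0"
  proof (cases l2)
    case 0
    then show ?thesis by (simp add: comm ev funpow_linear(3,4)[OF lin(3)])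
  next
    case (Suc j)
    have "(f2 ^^ j) v \<noteq> 0" using f2_string_length(1)[OF v0 ev(2) kv(2), of j] Suc by simp
    then have "(f1 ^^ ?N) ((f2 ^^ j) v) = 0"
      by (rule f1_string_length(2)[OF _ conjunct1[OF f2w] conjunct2[OF f2w]]) (use Suc in simp)
    then show ?thesis using f2_string(2)[OF ev(2) kv(2), of j] Suc
      by (simp add: comm funpow_linear(3,4)[OF lin(3)] del: funpow.simps)
  qed
  moreover have "k2 ((f1 ^^ k) ?y) = q powi (int k - int l2) *s (f1 ^^ k) ?y" for k
  proof (induction k)
    case 0
    then show ?case using f2_string(1)[OF ev(2) kv(2), of l2] by simp
  next
    case (Suc k)
    have "q powi (int (Suc k) - int l2) = q * q powi (int k - int l2)" by (simp add: powi_simps)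
    then show ?case using Suc by (simp add: kf linear_simps)
  qed
  from this[of ?N] have "k2 ?z = q powi int l1 *s ?z" by simp
  ultimately have nz: "(f2 ^^ l1) ?z \<noteq> 0" by (intro f2_string_length(1)[OF z]) auto
  let ?w = "tprod 0 0 h {1 - int l2..0} v"
  have weight: "?w \<in> weight h" by (rule tprod_linear(5)[OF _ v_weight]) simp
  have w: "?w = (f1 ^^ l2) ?y" using string_down_prod[OF v_weight, of l2 0 0] by (simp add: b_0)
  \<comment> \<open>Splitting \<open>f1^(l1+l2)\<close> as \<open>f1^l1 f1^l2\<close> gives an
    upward and a downward string product, whose index ranges are adjacent.\<close>
  have "(f2 ^^ l1) ?z = (f2 ^^ l1) ((f1 ^^ l1) ?w)" by (simp add: w funpow_add)
  also have "\<dots> = tprod 0 0 h {1..int l1} ?w"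
    using string_up_prod[OF weight, of l1 0 0] by (simp add: b_0)
  also have "\<dots> = tprod 0 0 h ({1..int l1} \<union> {1 - int l2..0}) v"
    by (rule tprod_Un[symmetric]) auto
  also have "{1..int l1} \<union> {1 - int l2..0} = {1 - int l2..int l1}" by auto
  finally show ?thesis using nz by simp
qed

abbreviation idx :: "int set" where "idx \<equiv> {- int l2..int l1 + 1}"

text \<open>Exchanging \<open>a\<close> for \<open>l1 + 1\<close> requires that the product without
  both of these vanish on \<open>v\<close>; it contains all of \<open>{- int l2..0}\<close>, so
  \<open>tprod_v_zero\<close> applies. The exchange of \<open>b\<close> for \<open>- l2\<close> is
  symmetric.\<close>

lemma tprod_nonzero_leading:
  assumes a: "a \<in> {1..int l1 + 1}" and b: "b \<in> {- int l2..0}"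
  shows "tprod 0 0 h (idx - {a, b}) v \<noteq> 0"
proof
  assume *: "tprod 0 0 h (idx - {a, b}) v = 0"
  let ?a = "int l1 + 1" and ?b = "- int l2"
  have ab: "tprod 0 0 h (idx - {?a, b}) v = 0"
  proof (cases "a = ?a")
    case False
    have "tprod 0 0 h (idx - {a, ?a}) v = 0"
      by (rule tprod_superset[OF _ _ tprod_v_zero(2)]) (use a in auto)
    then show ?thesis using a b False by (intro tprod_exchange[OF _ _ _ _ _ *]) auto
  qed (use * in simp)
  have "tprod 0 0 h (idx - {?b, ?a}) v = 0"
  proof (cases "b = ?b")
    case False
    have bb: "tprod 0 0 h (idx - {b, ?b}) v = 0"
      by (rule tprod_superset[OF _ _ tprod_v_zero(1)]) (use b in auto)
    have ba: "tprod 0 0 h (idx - {b, ?a}) v = 0" using ab by (simp only: insert_commute)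
    show ?thesis by (rule tprod_exchange[OF _ _ _ _ _ ba bb]) (use b False in auto)
  qed (use ab in \<open>simp only: insert_commute\<close>)
  moreover have "idx - {?b, ?a} = {1 - int l2..int l1}" by auto
  ultimately show False using corner_nonzero by simp
qed

lemma tprod_nonzero:
  assumes "a \<in> {1..int l1 + 1}" "b \<in> {- int l2..0}"
  shows "tprod c1 c2 h (idx - {a, b}) v \<noteq> 0"
proof
  assume *: "tprod c1 c2 h (idx - {a, b}) v = 0"
  have "v \<in> height (int l1 + int l2)" by (simp add: height_def kv linear_simps powi_simps mult.commute)
  \<comment> \<open>If the full product vanishes, its leading part lies both in one height and
    strictly above it.\<close>
  from tprod_leading[OF _ this, of "idx - {a, b}" h c1 c2] *
  have "tprod 0 0 h (idx - {a, b}) v = 0"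
    using height_above_disjoint height_above_closed(3)[of _ _ "- 1"] by fastforce
  then show False using tprod_nonzero_leading[OF assms] by blast
qed

end

section \<open>Decomposition into strings\<close>

lemma span_image_atMost:
  fixes w :: "nat \<Rightarrow> complex ^ 'n::finite"
  assumes "y \<in> vec.span (w ` {..n})"
  shows "\<exists>c. y = (\<Sum>k\<le>n. c k *s w k)"
  using assms
proof (induction rule: vec.span_induct_alt)
  case base
  show ?case by (rule exI[of _ "\<lambda>_. 0"]) simp
next
  case (step a x y)
  then obtain j c where "j \<le> n" "x = w j" "y = (\<Sum>k\<le>n. c k *s w k)" by auto
  then have "a *s x + y = (\<Sum>k\<le>n. ((if k = j then a else 0) + c k) *s w k)"
    by (simp add: vec.scale_left_distrib sum.distrib if_distrib[of "\<lambda>t. t *s _"] cong: if_cong)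
  then show ?case by (rule exI[of _ "\<lambda>k. (if k = j then a else 0) + c k"])
qed

lemma eigenvectors_independent:
  fixes w :: "nat \<Rightarrow> complex ^ 'n::finite"
  assumes lin: "Vector_Spaces.linear (*s) (*s) A" and eig: "\<And>k. k \<le> n \<Longrightarrow> A (w k) = \<mu> k *s w k"
    and inj: "inj_on \<mu> {..n}" and nz: "\<And>k. k \<le> n \<Longrightarrow> w k \<noteq> 0"
  shows "vec.dim (vec.span (w ` {..n})) = n + 1"
proof -
  have inj_w: "inj_on w {..n}"
  proof (rule inj_onI)
    fix i j assume ij: "i \<in> {..n}" "j \<in> {..n}" "w i = w j"
    then have "\<mu> i *s w i = \<mu> j *s w i" using eig[of i] eig[of j] by (metis atMost_iff)
    then have "\<mu> i = \<mu> j" using nz[of i] ij vec.scale_cancel_right by blast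
    then show "i = j" using inj ij by (auto dest: inj_onD)
  qed
  have "vec.independent (w ` {..n})"
    unfolding vec.dependent_def
  proof
    assume "\<exists>a\<in>w ` {..n}. a \<in> vec.span (w ` {..n} - {a})"
    then obtain i where i: "i \<le> n" "w i \<in> vec.span (w ` {..n} - {w i})" by blast
    have "w i = 0"
    proof (rule eigenvector_in_span_others[OF lin eig[OF i(1)] _ i(2)])
      fix x assume "x \<in> w ` {..n} - {w i}"
      then obtain j where j: "j \<le> n" "x = w j" "j \<noteq> i" by auto
      then have "\<mu> j \<noteq> \<mu> i" using inj i(1) by (auto dest: inj_onD)
      then show "\<exists>l. l \<noteq> \<mu> i \<and> A x = l *s x" using eig j by auto
    qed
    then show False using nz i by blast
  qed
  then show ?thesis using card_image[OF inj_w] vec.dim_span_eq_card_independent by force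
qed

text \<open>Any nonzero vector of \<open>U\<close> can be pushed along \<open>L\<close> until only a
  multiple of the last vector \<open>w n\<close> remains; from there \<open>R\<close> climbs back
  through the whole string.\<close>

lemma string_irreducible:
  fixes w :: "nat \<Rightarrow> complex ^ 'n::finite"
  assumes lin: "Vector_Spaces.linear (*s) (*s) L"
    and down: "\<And>k. L (w k) = w (Suc k)" and end_zero: "w (Suc n) = 0"
    and up: "\<And>k. k < n \<Longrightarrow> R (w (Suc k)) = t k *s w k" "\<And>k. k < n \<Longrightarrow> t k \<noteq> 0"
    and U: "vec.subspace U" "U \<subseteq> vec.span (w ` {..n})" "U \<noteq> {0}"
      "\<And>y. y \<in> U \<Longrightarrow> L y \<in> U" "\<And>y. y \<in> U \<Longrightarrow> R y \<in> U"
  shows "U = vec.span (w ` {..n})"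
proof -
  obtain y where y: "y \<in> U" "y \<noteq> 0" using U(1,3) vec.subspace_0 by blast
  then obtain c where c: "y = (\<Sum>k\<le>n. c k *s w k)" using U(2) span_image_atMost by blast
  have "\<exists>k. k \<le> n \<and> c k \<noteq> 0" using y(2) c by (auto intro: ccontr)
  \<comment> \<open>With \<open>m\<close> the least index that occurs, \<open>L^(n-m)\<close> sends
    \<open>w m\<close> to \<open>w n\<close> and every later vector to 0.\<close>
  then obtain m where m: "m \<le> n" "c m \<noteq> 0" "\<And>k. k < m \<Longrightarrow> c k = 0"
    using exists_least_iff[of "\<lambda>k. k \<le> n \<and> c k \<noteq> 0"] by (metis less_le_trans nless_le)
  have w_pow: "(L ^^ j) (w k) = w (k + j)" for j k by (induction j) (simp_all add: down)
  have w_zero: "w k = 0" if "n < k" for k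
    using that
    using w_pow[of "k - Suc n" "Suc n"] that end_zero funpow_linear(4)[OF lin] by simp
  have U_pow: "(L ^^ j) z \<in> U" if "z \<in> U" for j z using that U(4) by (induction j) auto
  have lin_pow: "(L ^^ j) (\<Sum>k\<in>X. c k *s w k) = (\<Sum>k\<in>X. c k *s w (k + j))" if "finite X" for j X
    by (induction j) (simp_all add: vec.linear_sum[OF lin] lin_simps(3)[OF lin] down)
  have "(L ^^ (n - m)) y = (\<Sum>k\<le>n. c k *s w (k + (n - m)))" unfolding c by (rule lin_pow) simp
  also have "\<dots> = (\<Sum>k\<in>{m}. c k *s w (k + (n - m)))"
    by (rule sum.mono_neutral_right) (use m w_zero in \<open>auto simp: not_less_iff_gr_or_eq neq_iff\<close>)
  also have "\<dots> = c m *s w n" using m(1) by simp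
  finally have "c m *s w n \<in> U" using U_pow[OF y(1), of "n - m"] by simp
  then have "inverse (c m) *s (c m *s w n) \<in> U" by (rule vec.subspace_scale[OF U(1)])
  then have top: "w n \<in> U" using m(2) by simp
  have "w k \<in> U" if "k \<le> n" for k
    using that
  proof (induction rule: inc_induct)
    case (step k)
    then have tw: "t k *s w k \<in> U" "t k \<noteq> 0" using U(5)[OF step.IH] up[of k] by simp_all
    have "inverse (t k) *s (t k *s w k) \<in> U" by (rule vec.subspace_scale[OF U(1) tw(1)])
    then show ?case using tw(2) by simp
  qed (rule top)
  then show ?thesis using U(1,2) by (intro antisym vec.span_minimal) auto
qed

lemma linear_span_closed:
  fixes A :: "complex ^ 'n::finite \<Rightarrow> complex ^ 'n"
  assumes lin: "Vector_Spaces.linear (*s) (*s) A" and "\<And>x. x \<in> X \<Longrightarrow> A x \<in> vec.span Y"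
    and "y \<in> vec.span X"
  shows "A y \<in> vec.span Y"
  using assms(3) by (induction rule: vec.span_induct_alt)
    (simp_all add: lin_simps[OF lin] vec.span_zero vec.span_add vec.span_scale assms(2))

lemma span_Union_sum:
  fixes W :: "'i \<Rightarrow> (complex ^ 'n::finite) set"
  assumes "\<And>j. vec.subspace (W j)" "finite I" "y \<in> vec.span (\<Union>j\<in>I. W j)"
  shows "\<exists>g. (\<forall>j\<in>I. g j \<in> W j) \<and> y = (\<Sum>j\<in>I. g j)"
  using assms(3)
proof (induction rule: vec.span_induct_alt)
  case base
  show ?case using vec.subspace_0[OF assms(1)] by (intro exI[of _ "\<lambda>_. 0"]) simp
next
  case (step a x y)
  then obtain j g where j: "j \<in> I" "x \<in> W j" and g: "\<forall>j\<in>I. g j \<in> W j" "y = (\<Sum>j\<in>I. g j)" by auto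
  have "(\<Sum>i\<in>I. (if i = j then a *s x else 0) + g i) = a *s x + y"
    using j assms(2) g(2) by (simp add: sum.distrib)
  moreover have "\<forall>i\<in>I. (if i = j then a *s x else 0) + g i \<in> W i"
    using g(1) j(2) vec.subspace_add[OF assms(1)] vec.subspace_scale[OF assms(1)] by simp
  ultimately show ?case by (intro exI[of _ "\<lambda>i. (if i = j then a *s x else 0) + g i"]) simp
qed

locale uq_coideal = uq_hw q e1 e2 f1 f2 k1 k2 m1 m2 v l1 l2
  for q and e1 e2 f1 f2 k1 k2 m1 m2 :: "complex ^ 'n::finite \<Rightarrow> complex ^ 'n" and v l1 l2 +
  fixes c1 c2 :: complex
  assumes c1: "c1 \<noteq> 0"
    and generic: "c2 / c1 \<noteq> - (q powi (2 * int l1 + 2 * int l2 + 1 - int m))"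
begin

lemma string_ev_nonzero:
  assumes "a \<in> {1..int l1 + 1}" "b \<in> {- int l2..0}" "m \<in> idx" "m \<noteq> a" "m \<noteq> b"
  shows "string_ev c1 c2 h a b m \<noteq> 0"
proof -
  let ?s = "a + b + m"
  have "c1 * q powi (?s - h - 2) + c2 * q powi (h + 1 - a - b - m) \<noteq> 0"
  proof
    assume *: "c1 * q powi (?s - h - 2) + c2 * q powi (h + 1 - a - b - m) = 0"
    have "c2 * q powi (h + 1 - a - b - m) = - (c1 * q powi (?s - h - 2))"
      using * by (simp add: add_eq_0_iff)
    then have "c2 / c1 = - (q powi (?s - h - 2) * inverse (q powi (h + 1 - a - b - m)))"
      using c1 powi_simps(5)[of "h + 1 - a - b - m"] by (simp add: field_simps)
    also have "\<dots> = - (q powi ((?s - h - 2) - (h + 1 - a - b - m)))" by (simp only: powi_simps(2))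
    \<comment> \<open>Since \<open>a\<close> and \<open>m\<close> are at most \<open>l1 + 1\<close>
      and \<open>b\<close> is at most 0, the argument of \<open>nat\<close> is nonnegative, so this
      is one of the excluded exponents.\<close>
    also have "(?s - h - 2) - (h + 1 - a - b - m) =
        2 * int l1 + 2 * int l2 + 1 - int (nat (4 * int l1 + 4 - 2 * ?s))"
      using assms by simp
    finally show False using generic by blast
  qed
  then show ?thesis using assms by (simp add: string_ev_def)
qed

text \<open>The kernel conditions alone do not end a string:
  \<open>string_op c1 c2 h (i + 1) e = 0\<close> only gives \<open>b2 b1^(i+1) e = 0\<close>. The
  nilpotency recorded here allows concluding \<open>b1^(i+1) e = 0\<close>.\<close>

definition admissible :: "(complex ^ 'n) set" where
  "admissible = {y \<in> weight h. (b1 c1 ^^ Suc l1) y = 0 \<and> (b2 c2 ^^ Suc l2) y = 0}"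

lemma highest_weight_decomposition:
  obtains e where "\<forall>a\<in>{1..int l1 + 1}. \<forall>b\<in>{- int l2..0}. e a b \<in> admissible \<and>
      string_op c1 c2 h a (e a b) = 0 \<and> string_op c1 c2 h b (e a b) = 0 \<and> e a b \<noteq> 0"
    and "v = (\<Sum>a\<in>{1..int l1 + 1}. \<Sum>b\<in>{- int l2..0}. e a b)"
proof -
  let ?A = "{1..int l1 + 1}" and ?B = "{- int l2..0}"
  have sub: "vec.subspace admissible"
    unfolding admissible_def vec.subspace_def using funpow_linear[OF b_lin(1)] funpow_linear[OF b_lin(2)]
    by (simp add: weight_closed del: funpow.simps)
  have closed: "string_op c1 c2 h m y \<in> admissible" if "y \<in> admissible" for m y
    using that string_op_weight b1_kernel_string_op b2_kernel_string_op unfolding admissible_def by blast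
  have v_adm: "v \<in> admissible" using v_weight b1_pow_v_zero b2_pow_v_zero by (simp add: admissible_def)
  have nz: "string_ev c1 c2 h a b m \<noteq> 0" if "a \<in> ?A" "b \<in> ?B" "m \<in> ?A \<union> ?B" "m \<noteq> a" "m \<noteq> b" for a b m
    using that by (intro string_ev_nonzero) auto
  have "?A \<inter> ?B = {}" by auto
  from interpolation[OF sub closed finite_atLeastAtMost_int finite_atLeastAtMost_int this nz v_adm tprod_v_zero]
  obtain e where e: "\<And>a b. a \<in> ?A \<Longrightarrow> b \<in> ?B \<Longrightarrow> e a b \<in> admissible \<and> string_op c1 c2 h a (e a b) = 0 \<and> string_op c1 c2 h b (e a b) = 0"
    and v: "v = (\<Sum>a\<in>?A. \<Sum>b\<in>?B. e a b)"
    by blast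
  have e0: "e a b \<noteq> 0" if ab: "a \<in> ?A" "b \<in> ?B" for a b
  proof
    assume "e a b = 0"
    have fin: "finite (idx - {a, b})" by simp
    \<comment> \<open>Any other pair differs from \<open>(a, b)\<close> in some index, and the
      operator of that index is a factor of the product; hence only \<open>e a b\<close> could
      contribute.\<close>
    have "tprod c1 c2 h (idx - {a, b}) (e a' b') = 0" if ab': "a' \<in> ?A" "b' \<in> ?B" for a' b'
    proof (cases "a' = a \<and> b' = b")
      case True
      then show ?thesis using \<open>e a b = 0\<close> fin by (simp add: tprod_linear)
    next
      case False
      then have "a' \<in> idx - {a, b} \<or> b' \<in> idx - {a, b}" using ab ab' by auto
      then show ?thesis using tprod_zero[OF fin] e[OF ab'] by blast
    qed
    then have "tprod c1 c2 h (idx - {a, b}) v = 0"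
      using v fin by (simp add: tprod_sum)
    then show False using tprod_nonzero[OF ab] by blast
  qed
  show thesis by (rule that[OF _ v]) (use e e0 in blast)
qed

lemma component_string:
  assumes e: "e \<in> admissible" "string_op c1 c2 h (int i + 1) e = 0" "string_op c1 c2 h (- int x) e = 0" "e \<noteq> 0"
    and ix: "i \<le> l1" "x \<le> l2"
  defines "w \<equiv> (b1 c1 ^^ i) e"
  shows "\<And>k. (b2 c2 ^^ k) w \<in> string_space c1 c2 h (int i + 1) (- int x) (int i - int k)"
    and "b1 c1 w = 0" and "(b2 c2 ^^ Suc (i + x)) w = 0"
    and "\<And>k. k \<le> i + x \<Longrightarrow> (b2 c2 ^^ k) w \<noteq> 0"
    and "\<exists>s. e = s *s (b2 c2 ^^ i) w"
proof -
  let ?a = "int i + 1" and ?b = "- int x"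
  have ab: "?a \<noteq> ?b" "?a \<in> {1..int l1 + 1}" "?b \<in> {- int l2..0}" using ix by auto
  let ?t = "string_ev c1 c2 h ?a ?b"
  have e0: "e \<in> string_space c1 c2 h ?a ?b 0"
    using e(1) string_op_joint_kernel[OF ab(1) e(2,3), of 0] string_op_joint_kernel[OF ab(1) e(2,3), of 1]
    by (simp add: string_space_def admissible_def string_op_0_1)
  have up: "(b1 c1 ^^ k) e \<in> string_space c1 c2 h ?a ?b (int k)" for k
    using string_space_pow(1)[OF ab(1) e0, of k] by simp
  have dn: "(b2 c2 ^^ k) e \<in> string_space c1 c2 h ?a ?b (- int k)" for k
    using string_space_pow(2)[OF ab(1) e0, of k] by simp
  have step_up: "b2 c2 ((b1 c1 ^^ Suc k) e) = ?t (int k + 1) *s (b1 c1 ^^ k) e" for k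
    using up[of k] by (simp add: string_space_def)
  have step_dn: "b1 c1 ((b2 c2 ^^ Suc k) e) = ?t (- int k) *s (b2 c2 ^^ k) e" for k
    using dn[of k] by (simp add: string_space_def)
  \<comment> \<open>Downward induction from \<open>l1 + 1\<close>: applying \<open>b2\<close> to the
    vanishing power \<open>k + 1\<close> returns a nonzero multiple of the power \<open>k\<close>.
    It stops at \<open>k = i + 1\<close>, as \<open>?t (int i + 1)\<close> is 0.\<close>
  have "(b1 c1 ^^ k) e = 0" if "Suc i \<le> k" "k \<le> Suc l1" for k
    using that(2,1)
  proof (induction rule: inc_induct)
    case base
    show ?case using e(1) by (simp add: admissible_def)
  next
    case (step k)
    have "?t (int k + 1) *s (b1 c1 ^^ k) e = 0" using step_up[of k] step by (simp add: b_linear)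
    moreover have "?t (int k + 1) \<noteq> 0" using step ix by (intro string_ev_nonzero[OF ab(2,3)]) auto
    ultimately show ?case by simp
  qed
  then have "(b1 c1 ^^ Suc i) e = 0" using ix by blast
  then show b1w: "b1 c1 w = 0" by (simp add: w_def)
  have "(b2 c2 ^^ k) e = 0" if "Suc x \<le> k" "k \<le> Suc l2" for k
    using that(2,1)
  proof (induction rule: inc_induct)
    case base
    show ?case using e(1) by (simp add: admissible_def)
  next
    case (step k)
    have "?t (- int k) *s (b2 c2 ^^ k) e = 0" using step_dn[of k] step by (simp add: b_linear)
    moreover have "?t (- int k) \<noteq> 0" using step ix by (intro string_ev_nonzero[OF ab(2,3)]) auto
    ultimately show ?case by simp
  qed
  then have b2e: "(b2 c2 ^^ Suc x) e = 0" using ix by blast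
  \<comment> \<open>\<open>b2^i b1^i\<close> acts on \<open>e\<close> as this product, which avoids
    the zero at \<open>i + 1\<close>; so \<open>w\<close> is nonzero and generates
    \<open>e\<close>.\<close>
  let ?p = "\<Prod>m\<in>{1..int i}. ?t m"
  have p: "(b2 c2 ^^ i) w = ?p *s e"
    using string_up_prod[of e h i c2 c1] e(1) tprod_eigen[OF _ ab(1) e(2,3)]
    by (simp add: w_def admissible_def)
  have p0: "?p \<noteq> 0"
    using string_ev_nonzero[OF ab(2,3)] ix by auto
  have "(b2 c2 ^^ Suc (i + x)) w = (b2 c2 ^^ Suc x) ((b2 c2 ^^ i) w)"
    using funpow_add[of "Suc x" i "b2 c2"] by (simp add: add.commute)
  then show "(b2 c2 ^^ Suc (i + x)) w = 0"
    unfolding p funpow_linear(3)[OF b_lin(2)] b2e by simp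
  show "\<exists>s. e = s *s (b2 c2 ^^ i) w"
    using p0 by (intro exI[of _ "inverse ?p"]) (simp add: p)
  show weight: "(b2 c2 ^^ k) w \<in> string_space c1 c2 h ?a ?b (int i - int k)" for k
    using string_space_pow(2)[OF ab(1) up[of i], of k] by (simp add: w_def)
  show "(b2 c2 ^^ k) w \<noteq> 0" if "k \<le> i + x" for k
    using that
  proof (induction k)
    case 0
    have "(b2 c2 ^^ i) w \<noteq> 0" using p p0 e(4) by simp
    then show ?case using funpow_linear(4)[OF b_lin(2)] by auto
  next
    case (Suc k)
    have "b1 c1 (b2 c2 ((b2 c2 ^^ k) w)) = ?t (int i - int k) *s (b2 c2 ^^ k) w"
      using weight[of k] by (simp add: string_space_def)
    moreover have "?t (int i - int k) \<noteq> 0" using Suc ix by (intro string_ev_nonzero[OF ab(2,3)]) auto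
    ultimately show ?case using Suc by (auto simp: b_linear)
  qed
qed

text \<open>On a word in the \<open>f\<close> applied to \<open>v\<close>, \<open>f1\<close> equals
  \<open>b1\<close> plus a multiple of \<open>e2\<close>, and \<open>f2\<close> equals
  \<open>b2\<close> plus a multiple of \<open>e1\<close>. The corrections are combinations of
  shorter words, so induction on length puts every word into \<open>U\<close>.\<close>

lemma coideal_generated:
  assumes U: "vec.subspace U" "\<And>y. y \<in> U \<Longrightarrow> b1 c1 y \<in> U" "\<And>y. y \<in> U \<Longrightarrow> b2 c2 y \<in> U" "v \<in> U"
  shows "U = UNIV"
proof -
  \<comment> \<open>\<open>D n\<close> holds the words of length \<open>n\<close> in
    \<open>f1\<close>, \<open>f2\<close> applied to \<open>v\<close>. The bound in
    \<open>L n\<close> is strict, so \<open>eD\<close> expresses that \<open>e1\<close> and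
    \<open>e2\<close> shorten words, starting from \<open>L 0\<close>, which is zero.\<close>
  define D where "D = rec_nat {v} (\<lambda>_ X. f1 ` X \<union> f2 ` X)"
  have D: "D 0 = {v}" "D (Suc n) = f1 ` D n \<union> f2 ` D n" for n by (simp_all add: D_def)
  define L where "L n = vec.span (\<Union>m<n. D m)" for n
  have base: "y \<in> L n" if "y \<in> D m" "m < n" for y m n
    unfolding L_def using that by (intro vec.span_base) auto
  have L: "vec.subspace (L n)" for n by (simp add: L_def)
  have f: "f1 y \<in> L (Suc n)" "f2 y \<in> L (Suc n)" if "y \<in> L n" for y n
  proof -
    from that[unfolded L_def] have "f1 y \<in> L (Suc n) \<and> f2 y \<in> L (Suc n)"
    proof (induction rule: vec.span_induct_alt)
      case base
      then show ?case using vec.subspace_0[OF L] by (simp add: linear_simps)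
    next
      case (step c x y)
      then obtain m where "m < n" "x \<in> D m" by auto
      then have "f1 x \<in> L (Suc n)" "f2 x \<in> L (Suc n)" using base[of _ "Suc m" "Suc n"] D(2) by auto
      then show ?case using step.IH vec.subspace_add[OF L] vec.subspace_scale[OF L] by (simp add: linear_simps)
    qed
    then show "f1 y \<in> L (Suc n)" "f2 y \<in> L (Suc n)" by simp_all
  qed
  have wtD: "\<exists>a b. k1 y = q powi a *s y \<and> k2 y = q powi b *s y" if "y \<in> D n" for y n
    using that
  proof (induction n arbitrary: y)
    case 0
    then have "y = v" using D(1) by simp
    then show ?case using kv by blast
  next
    case (Suc n)
    then obtain z where z: "z \<in> D n" "y = f1 z \<or> y = f2 z" using D by auto
    then obtain a b where "k1 z = q powi a *s z" "k2 z = q powi b *s z" using Suc.IH by blast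
    then have "k1 (f1 z) = q powi (a - 2) *s f1 z" "k2 (f1 z) = q powi (b + 1) *s f1 z"
      "k1 (f2 z) = q powi (a + 1) *s f2 z" "k2 (f2 z) = q powi (b - 2) *s f2 z"
      by (simp_all add: kf linear_simps powi_simps power_inverse mult.commute)
    then show ?case using z(2) by blast
  qed
  have kD: "\<exists>s. g y = s *s y" if "y \<in> D n" "g \<in> {k1, k2, m1, m2}" for y n g
    using wtD[OF that(1)] m_eigen that(2) by blast
  have eD: "e1 y \<in> L n \<and> e2 y \<in> L n" if "y \<in> D n" for y n
    using that
  proof (induction n arbitrary: y)
    case 0
    then show ?case using ev D vec.subspace_0[OF L] by simp
  next
    case (Suc n)
    then obtain z where z: "z \<in> D n" "y = f1 z \<or> y = f2 z" using D by auto
    have zL: "s *s z \<in> L (Suc n)" for s using base[OF z(1), of "Suc n"] vec.subspace_scale[OF L] by simp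
    have diff: "\<exists>s. c *s (g z - g' z) = s *s z" if "g \<in> {k1, k2, m1, m2}" "g' \<in> {k1, k2, m1, m2}" for c g g'
    proof -
      obtain s s' where "g z = s *s z" "g' z = s' *s z" using kD[OF z(1)] \<open>g \<in> _\<close> \<open>g' \<in> _\<close> by blast
      then have "c *s (g z - g' z) = (c * (s - s')) *s z" by (simp add: vec_eq_iff algebra_simps)
      then show ?thesis by blast
    qed
    obtain s1 s2 where "(1 / (q - inverse q)) *s (k1 z - m1 z) = s1 *s z" "(1 / (q - inverse q)) *s (k2 z - m2 z) = s2 *s z"
      using diff[of k1 m1] diff[of k2 m2] by blast
    then have "e1 (f1 z) \<in> L (Suc n)" "e2 (f2 z) \<in> L (Suc n)" "e1 (f2 z) \<in> L (Suc n)" "e2 (f1 z) \<in> L (Suc n)"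
      using f Suc.IH[OF z(1)] zL vec.subspace_add[OF L] by (simp_all only: ef)
    then show ?case using z(2) by auto
  qed
  define G where "G = vec.span (\<Union>n. D n)"
  have LG: "L n \<subseteq> G" for n unfolding L_def G_def by (rule vec.span_mono) auto
  have "g y \<in> G" if g: "g \<in> {e1, e2, f1, f2, k1, k2, m1, m2}" and "y \<in> G" for g y
    using \<open>y \<in> G\<close>[unfolded G_def]
  proof (induction rule: vec.span_induct_alt)
    case base
    then show ?case using g by (auto simp: linear_simps G_def vec.span_zero)
  next
    case (step c x y)
    then obtain n where n: "x \<in> D n" by auto
    then have "x \<in> G" by (auto simp: G_def intro: vec.span_base)
    then have "g x \<in> G" if "g \<in> {k1, k2, m1, m2}"
      using kD[OF n that] vec.span_scale unfolding G_def by metis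
    moreover have "f1 x \<in> G" "f2 x \<in> G" using n D(2)[of n] unfolding G_def by (blast intro: vec.span_base)+
    moreover have "e1 x \<in> G" "e2 x \<in> G" using eD[OF n] LG by auto
    ultimately have "g x \<in> G" using g by blast
    moreover have "g (c *s x + y) = c *s g x + g y" using g by (auto simp: linear_simps)
    ultimately show ?case using step.IH unfolding G_def by (simp add: vec.span_add vec.span_scale)
  qed
  moreover have "v \<in> G" unfolding G_def using D(1) by (intro vec.span_base) blast
  ultimately have "G = UNIV" by (intro generated) (auto simp: G_def)
  moreover have "D n \<subseteq> U" for n
  proof (induction n rule: less_induct)
    case (less n)
    show ?case
    proof (cases n)
      case 0
      then show ?thesis using D U(4) by simp
    next
      case (Suc n')
      have LU: "L n' \<subseteq> U" unfolding L_def using less.IH Suc by (intro vec.span_minimal U(1) UN_least) simp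
      have "f1 z \<in> U \<and> f2 z \<in> U" if z: "z \<in> D n'" for z
      proof -
        have "z \<in> U" using less.IH z Suc by auto
        obtain s1 s2 where s: "m1 z = s1 *s z" "m2 z = s2 *s z" using kD[OF z] by blast
        have "e1 z \<in> U" "e2 z \<in> U" using eD[OF z] LU by auto
        moreover have "f1 z = b1 c1 z + (c1 * s1) *s e2 z" "f2 z = b2 c2 z + (c2 * s2) *s e1 z"
          by (simp_all add: b1_def b2_def s linear_simps)
        ultimately show ?thesis using U \<open>z \<in> U\<close> vec.subspace_add[OF U(1)] vec.subspace_scale[OF U(1)] by simp
      qed
      then show ?thesis unfolding Suc D(2) by auto
    qed
  qed
  then have "G \<subseteq> U" unfolding G_def by (intro vec.span_minimal U(1)) auto
  ultimately show ?thesis by auto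
qed

lemma decomposition:
  "\<exists>W. direct_sum_decomp ({0..l1} \<times> {0..l2}) W \<and> (\<forall>i\<le>l1. \<forall>x\<le>l2.
     vec.subspace (W (i, x)) \<and> (\<forall>A\<in>{bK, bM, b1 c1, b2 c2}. \<forall>y\<in>W (i, x). A y \<in> W (i, x)) \<and>
     vec.dim (W (i, x)) = i + x + 1 \<and>
     (\<forall>U. vec.subspace U \<longrightarrow> (\<forall>A\<in>{bK, bM, b1 c1, b2 c2}. \<forall>y\<in>U. A y \<in> U) \<longrightarrow> U \<subseteq> W (i, x) \<longrightarrow>
       U = {0} \<or> U = W (i, x)) \<and>
     (\<exists>w\<in>W (i, x). w \<noteq> 0 \<and> b1 c1 w = 0 \<and> bK w = q powi (h - 3 * int i) *s w))"
proof -
  obtain e where eb: "\<forall>a\<in>{1..int l1 + 1}. \<forall>b\<in>{- int l2..0}. e a b \<in> admissible \<and>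
      string_op c1 c2 h a (e a b) = 0 \<and> string_op c1 c2 h b (e a b) = 0 \<and> e a b \<noteq> 0"
    and v_sum: "v = (\<Sum>a\<in>{1..int l1 + 1}. \<Sum>b\<in>{- int l2..0}. e a b)"
    by (rule highest_weight_decomposition) (rule that)
  have e: "e a b \<in> admissible \<and> string_op c1 c2 h a (e a b) = 0 \<and> string_op c1 c2 h b (e a b) = 0 \<and> e a b \<noteq> 0"
    if "a \<in> {1..int l1 + 1}" "b \<in> {- int l2..0}" for a b using eb that by blast
  \<comment> \<open>\<open>w i x\<close> sits at position \<open>i\<close>, the end killed by
    \<open>b1\<close>, and \<open>u i x k\<close> at position \<open>i - k\<close>; thus
    \<open>k = i + x\<close> is the other end, position \<open>- x\<close>.\<close>
  define w where "w i x = (b1 c1 ^^ i) (e (int i + 1) (- int x))" for i x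
  define u where "u i x k = (b2 c2 ^^ k) (w i x)" for i x k
  have string: "u i x k \<in> string_space c1 c2 h (int i + 1) (- int x) (int i - int k)" "b1 c1 (u i x 0) = 0"
      "u i x (Suc (i + x)) = 0" "k \<le> i + x \<Longrightarrow> u i x k \<noteq> 0"
      "\<exists>s. e (int i + 1) (- int x) = s *s u i x i" if "i \<le> l1" "x \<le> l2" for i x k
  proof -
    have "int i + 1 \<in> {1..int l1 + 1}" "- int x \<in> {- int l2..0}" using that by auto
    note E = e[OF this]
    note comp = component_string[OF conjunct1[OF E] conjunct1[OF conjunct2[OF E]]
      conjunct1[OF conjunct2[OF conjunct2[OF E]]] conjunct2[OF conjunct2[OF conjunct2[OF E]]] that]
    show "u i x k \<in> string_space c1 c2 h (int i + 1) (- int x) (int i - int k)"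
      "k \<le> i + x \<Longrightarrow> u i x k \<noteq> 0" "\<exists>s. e (int i + 1) (- int x) = s *s u i x i"
      unfolding u_def w_def by (rule comp | assumption)+
    show "b1 c1 (u i x 0) = 0" unfolding u_def w_def funpow_0 by (rule comp(2))
    show "u i x (Suc (i + x)) = 0" unfolding u_def w_def by (rule comp(3))
  qed
  define W where "W = (\<lambda>(i, x). vec.span (u i x ` {..i + x}))"
  have W: "W (i, x) = vec.span (u i x ` {..i + x})" for i x by (simp add: W_def)
  have u_W: "u i x k \<in> W (i, x)" if "k \<le> i + x" for i x k
    using that unfolding W by (intro vec.span_base) auto
  have u_b2: "b2 c2 (u i x k) = u i x (Suc k)" for i x k by (simp add: u_def)
  have u_b1: "b1 c1 (u i x (Suc k)) = string_ev c1 c2 h (int i + 1) (- int x) (int i - int k) *s u i x k"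
    if "i \<le> l1" "x \<le> l2" for i x k
    using string(1)[OF that, of k] by (simp add: string_space_def u_b2)
  have u_bK: "bK (u i x k) = q powi (h - 3 * (int i - int k)) *s u i x k"
    and u_bM: "bM (u i x k) = inverse (q powi (h - 3 * (int i - int k))) *s u i x k"
    if "i \<le> l1" "x \<le> l2" for i x k
    using string(1)[OF that, of k] weight_bM[of "u i x k"] by (simp_all add: string_space_def weight_def)
  have W_sub: "vec.subspace (W j)" for j by (simp add: W_def split_beta)
  have W_inv: "A y \<in> W (i, x)" if ix: "i \<le> l1" "x \<le> l2" and A: "A \<in> {bK, bM, b1 c1, b2 c2}" and y: "y \<in> W (i, x)"
    for i x A y
  proof -
    have A_u: "A (u i x k) \<in> W (i, x)" if "k \<le> i + x" for k
    proof -
      have "bK (u i x k) \<in> W (i, x)" "bM (u i x k) \<in> W (i, x)"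
        using u_bK[OF ix] u_bM[OF ix] u_W[OF that] vec.subspace_scale[OF W_sub] by simp_all
      moreover have "b2 c2 (u i x k) \<in> W (i, x)"
        using u_W[of "Suc k" i x] string(3)[OF ix] that vec.subspace_0[OF W_sub]
        by (cases "k = i + x") (simp_all add: u_b2)
      moreover have "b1 c1 (u i x k) \<in> W (i, x)"
      proof (cases k)
        case 0
        then show ?thesis using string(2)[OF ix] vec.subspace_0[OF W_sub] by simp
      next
        case (Suc j)
        then show ?thesis using u_b1[OF ix] u_W[of j i x] that vec.subspace_scale[OF W_sub] by simp
      qed
      ultimately show ?thesis using A by blast
    qed
    have lin_A: "Vector_Spaces.linear (*s) (*s) A" using A b_lin by blast
    show ?thesis unfolding W
    proof (rule linear_span_closed[OF lin_A _ y[unfolded W]])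
      fix z assume "z \<in> u i x ` {..i + x}"
      then obtain k where "k \<le> i + x" "z = u i x k" by auto
      then show "A z \<in> vec.span (u i x ` {..i + x})" using A_u[unfolded W] by simp
    qed
  qed
  have "vec.span (\<Union>j\<in>{0..l1} \<times> {0..l2}. W j) = UNIV"
  proof (rule coideal_generated)
    have closed: "A y \<in> vec.span (\<Union>j\<in>{0..l1} \<times> {0..l2}. W j)"
      if "A \<in> {bK, bM, b1 c1, b2 c2}" "y \<in> vec.span (\<Union>j\<in>{0..l1} \<times> {0..l2}. W j)" for A y
    proof (rule linear_span_closed[OF _ _ that(2)])
      show "Vector_Spaces.linear (*s) (*s) A" using that(1) b_lin by blast
      fix z assume "z \<in> (\<Union>j\<in>{0..l1} \<times> {0..l2}. W j)"
      then obtain i x where "i \<le> l1" "x \<le> l2" "z \<in> W (i, x)" by auto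
      then show "A z \<in> vec.span (\<Union>j\<in>{0..l1} \<times> {0..l2}. W j)"
        using W_inv[OF _ _ that(1)] by (intro vec.span_base UN_I[of "(i, x)"]) auto
    qed
    show "b1 c1 y \<in> vec.span (\<Union>j\<in>{0..l1} \<times> {0..l2}. W j)" "b2 c2 y \<in> vec.span (\<Union>j\<in>{0..l1} \<times> {0..l2}. W j)"
      if "y \<in> vec.span (\<Union>j\<in>{0..l1} \<times> {0..l2}. W j)" for y
      using closed that by blast+
    have "e a b \<in> vec.span (\<Union>j\<in>{0..l1} \<times> {0..l2}. W j)" if ab: "a \<in> {1..int l1 + 1}" "b \<in> {- int l2..0}" for a b
    proof -
      obtain i x where ix: "a = int i + 1" "b = - int x" "i \<le> l1" "x \<le> l2"
        by (rule that[of "nat (a - 1)" "nat (- b)"]) (use ab in auto)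
      obtain s where "e a b = s *s u i x i" using string(5)[OF ix(3,4)] ix by blast
      then have "e a b \<in> W (i, x)" using u_W[of i i x] vec.subspace_scale[OF W_sub] by simp
      then show ?thesis using ix by (intro vec.span_base UN_I[of "(i, x)"]) auto
    qed
    then show "v \<in> vec.span (\<Union>j\<in>{0..l1} \<times> {0..l2}. W j)"
      unfolding v_sum by (intro vec.span_sum) auto
  qed (rule vec.subspace_span)
  then have exist: "\<exists>g. (\<forall>j\<in>{0..l1} \<times> {0..l2}. g j \<in> W j) \<and> y = (\<Sum>j\<in>{0..l1} \<times> {0..l2}. g j)" for y
    by (intro span_Union_sum W_sub) auto
  have indep: "d j = 0" if d: "\<And>j. j \<in> {0..l1} \<times> {0..l2} \<Longrightarrow> d j \<in> W j"
    and sum0: "(\<Sum>j\<in>{0..l1} \<times> {0..l2}. d j) = 0" and j: "j \<in> {0..l1} \<times> {0..l2}" for d j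
  proof -
    have "\<forall>j\<in>{0..l1} \<times> {0..l2}. \<exists>c. d j = (\<Sum>k\<le>fst j + snd j. c k *s u (fst j) (snd j) k)"
      using d span_image_atMost by (fastforce simp: W)
    then obtain c where c: "\<And>j. j \<in> {0..l1} \<times> {0..l2} \<Longrightarrow>
        d j = (\<Sum>k\<le>fst j + snd j. c j k *s u (fst j) (snd j) k)" by metis
    define P where "P = (SIGMA j:{0..l1} \<times> {0..l2}. {..fst j + snd j})"
    define y where "y = (\<lambda>(j, k). c j k *s u (fst j) (snd j) k)"
    \<comment> \<open>\<open>bK\<close> detects the position \<open>i - k\<close>; the other two
      operators detect the values of the eigenvalue sequence at this position and the next one,
      hence the whole sequence.\<close>
    define opr where "opr = (\<lambda>s::nat. if s = 0 then bK else if s = 1 then (\<lambda>z. b1 c1 (b2 c2 z)) else (\<lambda>z. b2 c2 (b1 c1 z)))"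
    define ev where "ev = (\<lambda>(s::nat) ((i, x), k). if s = 0 then q powi (h - 3 * (int i - int k))
      else string_ev c1 c2 h (int i + 1) (- int x) (int i - int k + (if s = 1 then 0 else 1)))"
    have y_zero: "y p = 0" if p: "p \<in> P" for p
    proof (rule joint_eigenvectors_sum_zero[where P = P and As = "{0, 1, 2::nat}" and T = opr and ev = ev and p = p])
      show "finite P" by (simp add: P_def)
      show "(\<Sum>p\<in>P. y p) = 0"
      proof -
        have "(\<Sum>p\<in>P. y p) = (\<Sum>j\<in>{0..l1} \<times> {0..l2}. \<Sum>k\<le>fst j + snd j. c j k *s u (fst j) (snd j) k)"
          unfolding P_def y_def by (rule sum.Sigma[symmetric]) auto
        also have "\<dots> = (\<Sum>j\<in>{0..l1} \<times> {0..l2}. d j)" by (rule sum.cong) (simp_all only: c)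
        finally show ?thesis using sum0 by simp
      qed
      show "Vector_Spaces.linear (*s) (*s) (opr s)" for s
        by (simp add: opr_def Vector_Spaces.linear_iff b_linear vec.vector_space_axioms)
      show "opr s (y p) = ev s p *s y p" if pP: "p \<in> P" for s p
      proof -
        obtain i x k where p: "p = ((i, x), k)" "i \<le> l1" "x \<le> l2" using pP by (auto simp: P_def)
        show ?thesis using string(1)[OF p(2,3), of k] u_bK[OF p(2,3), of k]
          by (simp add: p(1) opr_def ev_def y_def string_space_def b_linear mult.commute)
      qed
      show "\<exists>s\<in>{0, 1, 2}. ev s p \<noteq> ev s p'" if pP: "p \<in> P" "p' \<in> P" "p \<noteq> p'" for p p'
      proof (rule ccontr)
        assume *: "\<not> (\<exists>s\<in>{0, 1, 2}. ev s p \<noteq> ev s p')"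
        obtain i x k where p: "p = ((i, x), k)" "i \<le> l1" "x \<le> l2" using pP(1) by (auto simp: P_def)
        obtain i' x' k' where p': "p' = ((i', x'), k')" "i' \<le> l1" "x' \<le> l2" using pP(2) by (auto simp: P_def)
        have "ev 0 p = ev 0 p'" "ev 1 p = ev 1 p'" "ev 2 p = ev 2 p'" using * by auto
        then have m: "int i - int k = int i' - int k'"
          and t: "string_ev c1 c2 h (int i + 1) (- int x) (int i - int k) = string_ev c1 c2 h (int i' + 1) (- int x') (int i' - int k')"
          "string_ev c1 c2 h (int i + 1) (- int x) (int i - int k + 1) = string_ev c1 c2 h (int i' + 1) (- int x') (int i' - int k' + 1)"
          by (auto simp: ev_def p p' dest: powi_inject)
        have same: "string_ev c1 c2 h (int i + 1) (- int x) n = string_ev c1 c2 h (int i' + 1) (- int x') n" for n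
          by (rule string_ev_determines[OF _ _ t[folded m]]) simp_all
        \<comment> \<open>Within \<open>idx\<close> the sequence of \<open>(i', x')\<close> vanishes
          only at \<open>i' + 1\<close> and \<open>- x'\<close>. One is positive and the other is
          not, so the zeros identify \<open>i\<close> and \<open>x\<close>.\<close>
        have "string_ev c1 c2 h (int i' + 1) (- int x') (int i + 1) = 0" "string_ev c1 c2 h (int i' + 1) (- int x') (- int x) = 0"
          unfolding same[symmetric] by (simp_all add: string_ev_def)
        then have "i = i'" "x = x'"
          using string_ev_nonzero[of "int i' + 1" "- int x'" "int i + 1"] string_ev_nonzero[of "int i' + 1" "- int x'" "- int x"] p p'
          by force+
        then show False using m pP(3) p p' by simp
      qed
    qed (use p in simp)
    show ?thesis unfolding c[OF j]
    proof (rule sum.neutral, rule ballI)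
      fix k assume "k \<in> {..fst j + snd j}"
      then have "(j, k) \<in> P" using j by (simp add: P_def)
      from y_zero[OF this] show "c j k *s u (fst j) (snd j) k = 0" by (simp add: y_def)
    qed
  qed
  have direct: "direct_sum_decomp ({0..l1} \<times> {0..l2}) W"
    unfolding direct_sum_decomp_def
  proof (intro allI ex_ex1I)
    fix y
    obtain g where "\<forall>j\<in>{0..l1} \<times> {0..l2}. g j \<in> W j" "y = (\<Sum>j\<in>{0..l1} \<times> {0..l2}. g j)"
      using exist[of y] by blast
    then show "\<exists>g. g \<in> (\<Pi>\<^sub>E j\<in>{0..l1} \<times> {0..l2}. W j) \<and> y = (\<Sum>j\<in>{0..l1} \<times> {0..l2}. g j)"
      by (intro exI[of _ "restrict g ({0..l1} \<times> {0..l2})"]) (simp add: restrict_PiE_iff Pi_iff)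
  next
    fix y g g'
    assume g: "g \<in> (\<Pi>\<^sub>E j\<in>{0..l1} \<times> {0..l2}. W j) \<and> y = (\<Sum>j\<in>{0..l1} \<times> {0..l2}. g j)"
      and g': "g' \<in> (\<Pi>\<^sub>E j\<in>{0..l1} \<times> {0..l2}. W j) \<and> y = (\<Sum>j\<in>{0..l1} \<times> {0..l2}. g' j)"
    show "g = g'"
    proof (rule PiE_ext[OF conjunct1[OF g] conjunct1[OF g']])
      fix j assume "j \<in> {0..l1} \<times> {0..l2}"
      then have "g j - g' j = 0"
        using g g' by (intro indep[where d = "\<lambda>j. g j - g' j"] vec.subspace_diff[OF W_sub])
          (auto simp: sum_subtractf PiE_iff)
      then show "g j = g' j" by simp
    qed
  qed
  have dim: "vec.dim (W (i, x)) = i + x + 1" if "i \<le> l1" "x \<le> l2" for i x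
    unfolding W
  proof (rule eigenvectors_independent[OF b_lin(3) u_bK[OF that] _ string(4)[OF that]])
    show "inj_on (\<lambda>k. q powi (h - 3 * (int i - int k))) {..i + x}"
      by (rule inj_onI) (auto dest: powi_inject)
  qed
  have irred: "U = W (i, x)" if ix: "i \<le> l1" "x \<le> l2" and U: "vec.subspace U" "U \<subseteq> W (i, x)" "U \<noteq> {0}"
      "\<And>A y. A \<in> {bK, bM, b1 c1, b2 c2} \<Longrightarrow> y \<in> U \<Longrightarrow> A y \<in> U" for i x U
    unfolding W
  proof (rule string_irreducible[OF b_lin(2) u_b2 string(3)[OF ix] u_b1[OF ix] _ U(1) _ U(3)])
    show "string_ev c1 c2 h (int i + 1) (- int x) (int i - int k) \<noteq> 0" if "k < i + x" for k
      using that ix by (intro string_ev_nonzero) auto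
  qed (use U W in auto)
  have highest: "\<exists>w\<in>W (i, x). w \<noteq> 0 \<and> b1 c1 w = 0 \<and> bK w = q powi (h - 3 * int i) *s w"
    if "i \<le> l1" "x \<le> l2" for i x
    using string(2,4)[OF that] u_bK[OF that, of 0] u_W[of 0 i x] by (intro bexI[of _ "u i x 0"]) auto
  show ?thesis
  proof (rule exI[of _ W], rule conjI[OF direct], intro allI impI conjI)
    fix i x assume ix: "i \<le> l1" "x \<le> l2"
    show "vec.subspace (W (i, x))" by (rule W_sub)
    show "\<forall>A\<in>{bK, bM, b1 c1, b2 c2}. \<forall>y\<in>W (i, x). A y \<in> W (i, x)" using W_inv[OF ix] by blast
    show "vec.dim (W (i, x)) = i + x + 1" by (rule dim[OF ix])
    show "\<exists>w\<in>W (i, x). w \<noteq> 0 \<and> b1 c1 w = 0 \<and> bK w = q powi (h - 3 * int i) *s w" by (rule highest[OF ix])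
    fix U assume "vec.subspace U" "\<forall>A\<in>{bK, bM, b1 c1, b2 c2}. \<forall>y\<in>U. A y \<in> U" "U \<subseteq> W (i, x)"
    then show "U = {0} \<or> U = W (i, x)" using irred[OF ix, of U] by blast
  qed
qed

end

section \<open>Matrix representations\<close>

lemma cmult_vector: "cmult c A *v x = c *s (A *v x)"
  by (simp add: cmult_def matrix_vector_mult_def vec_eq_iff sum_distrib_left mult.assoc)

lemma matrix_linear: "Vector_Spaces.linear (*s) (*s) ((*v) (A :: complex ^ 'n::finite ^ 'n))"
  by (rule matrix_vector_mul_linear_gen)

lemma powi_neq_1:
  assumes "0 < (q::real)" "q < 1" "k \<noteq> 0"
  shows "complex_of_real q powi k \<noteq> 1"
proof -
  have pos: "q ^ n \<noteq> 1" if "n \<noteq> 0" for n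
    using assms that power_strict_mono[of q 1 n] by simp
  have "q powi k \<noteq> 1"
  proof (cases "k \<ge> 0")
    case True
    then show ?thesis using pos[of "nat k"] assms by (simp add: power_int_def)
  next
    case False
    then show ?thesis using pos[of "nat (- k)"] assms by (simp add: power_int_def power_inverse)
  qed
  then show ?thesis by (metis of_real_power_int of_real_eq_1_iff)
qed

lemma Uq_rep_module:
  assumes q: "0 < q" "q < 1" and rep: "Uq_rep q E F K Ki"
  shows "uq_module (complex_of_real q) ((*v) (E 1)) ((*v) (E 2)) ((*v) (F 1)) ((*v) (F 2))
    ((*v) (K 1)) ((*v) (K 2)) ((*v) (Ki 1)) ((*v) (Ki 2))"
proof -
  let ?q = "complex_of_real q"
  note rep' = rep[unfolded Uq_rep_def Let_def]
  have comm: "A *v (B *v x) = B *v (A *v x)" if "A \<in> K ` {1, 2} \<union> Ki ` {1, 2}" "B \<in> K ` {1, 2} \<union> Ki ` {1, 2}" for A B x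
    using rep' that by (simp only: matrix_vector_mul_assoc)
  have inv: "K i *v (Ki i *v x) = x" "Ki i *v (K i *v x) = x" if "i \<in> {1, 2}" for i x
    using rep' that by (auto simp only: matrix_vector_mul_assoc matrix_vector_mul_lid)
  have KE: "K i *v (E j *v x) = (?q powi cartan i j) *s (E j *v (K i *v x))" if "i \<in> {1, 2}" "j \<in> {1, 2}" for i j x
  proof -
    have "K i ** E j = cmult (?q powi cartan i j) (E j ** K i)" using rep' that by blast
    then show ?thesis by (metis matrix_vector_mul_assoc cmult_vector)
  qed
  have KF: "K i *v (F j *v x) = (?q powi (- cartan i j)) *s (F j *v (K i *v x))" if "i \<in> {1, 2}" "j \<in> {1, 2}" for i j x
  proof -
    have "K i ** F j = cmult (?q powi (- cartan i j)) (F j ** K i)" using rep' that by blast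
    then show ?thesis by (metis matrix_vector_mul_assoc cmult_vector)
  qed
  have EF: "E i *v (F j *v x) = F j *v (E i *v x) +
      (if i = j then (1 / (?q - inverse ?q)) *s (K i *v x - Ki i *v x) else 0)" if "i \<in> {1, 2}" "j \<in> {1, 2}" for i j x
  proof -
    have "E i ** F j - F j ** E i = (if i = j then cmult (1 / (?q - inverse ?q)) (K i - Ki i) else 0)"
      using rep' that by blast
    from arg_cong[OF this, of "\<lambda>A. A *v x"]
    have "E i *v (F j *v x) - F j *v (E i *v x) =
        (if i = j then (1 / (?q - inverse ?q)) *s (K i *v x - Ki i *v x) else 0)"
      by (auto simp: matrix_vector_mult_diff_rdistrib matrix_vector_mul_assoc[symmetric] cmult_vector split: if_splits)
    then show ?thesis unfolding diff_eq_eq by (simp only: add.commute)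
  qed
  have serre: "X i *v (X i *v (X j *v x)) - (?q + inverse ?q) *s (X i *v (X j *v (X i *v x))) + X j *v (X i *v (X i *v x)) = 0"
    if "i \<in> {1, 2}" "j \<in> {1, 2}" "i \<noteq> j" "X = E \<or> X = F" for i j x X
  proof -
    have "X i ** X i ** X j - cmult (?q + inverse ?q) (X i ** X j ** X i) + X j ** X i ** X i = 0"
      using rep' that by blast
    from arg_cong[OF this, of "\<lambda>A. A *v x"] show ?thesis
      by (simp add: matrix_vector_mult_diff_rdistrib matrix_vector_mult_add_rdistrib matrix_vector_mul_assoc[symmetric] cmult_vector)
  qed
  have c: "cartan 1 1 = 2" "cartan 2 2 = 2" "cartan 1 2 = -1" "cartan 2 1 = -1" by (simp_all add: cartan_def)
  have pw: "?q powi 2 = ?q ^ 2" "?q powi - 2 = inverse ?q ^ 2" "?q powi - 1 = inverse ?q" "?q powi 1 = ?q"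
    by (simp_all add: power_int_minus power_inverse)
  have i12: "(1::nat) \<in> {1, 2}" "(2::nat) \<in> {1, 2}" "(1::nat) \<noteq> 2" "(2::nat) \<noteq> 1" by auto
  have mem: "K 1 \<in> K ` {1, 2} \<union> Ki ` {1, 2}" "K 2 \<in> K ` {1, 2} \<union> Ki ` {1, 2}"
    "Ki 1 \<in> K ` {1, 2} \<union> Ki ` {1, 2}" "Ki 2 \<in> K ` {1, 2} \<union> Ki ` {1, 2}" by auto
  show ?thesis
  proof (intro uq_module.intro matrix_linear)
    show "?q \<noteq> 0" using q by simp
    show "?q powi k \<noteq> 1" if "k \<noteq> 0" for k by (rule powi_neq_1[OF q that])
  qed (fact comm[OF mem(2) mem(1)] comm[OF mem(4) mem(3)] comm[OF mem(2) mem(3)] comm[OF mem(4) mem(1)]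
      inv[OF i12(1)] inv[OF i12(2)]
      KE[OF i12(1) i12(1), unfolded c pw] KE[OF i12(2) i12(2), unfolded c pw]
      KE[OF i12(1) i12(2), unfolded c pw] KE[OF i12(2) i12(1), unfolded c pw]
      KF[OF i12(1) i12(1), unfolded c pw] KF[OF i12(2) i12(2), unfolded c pw]
      KF[OF i12(1) i12(2), unfolded c minus_minus pw] KF[OF i12(2) i12(1), unfolded c minus_minus pw]
      EF[OF i12(1) i12(1), unfolded if_P[OF refl]] EF[OF i12(2) i12(2), unfolded if_P[OF refl]]
      EF[OF i12(1) i12(2), unfolded if_not_P[OF i12(3)] add_0_right] EF[OF i12(2) i12(1), unfolded if_not_P[OF i12(4)] add_0_right]
      serre[OF i12(1) i12(2) i12(3) disjI1[OF refl]] serre[OF i12(2) i12(1) i12(4) disjI1[OF refl]]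
      serre[OF i12(1) i12(2) i12(3) disjI2[OF refl]] serre[OF i12(2) i12(1) i12(4) disjI2[OF refl]])+
qed

theorem theorem4p1:
  fixes q :: real and l1 l2 :: nat and c1 c2 :: complex
    and E F K Ki :: "nat \<Rightarrow> complex ^ ('n::finite) ^ 'n"
  assumes q: "0 < q" "q < 1"
    and rep: "Uq_rep q E F K Ki"
    and irr: "irreducible_on (U_ops E F K Ki) UNIV"
    and hw: "\<exists>v :: complex ^ 'n. v \<noteq> 0 \<and> E 1 *v v = 0 \<and> E 2 *v v = 0 \<and>
               K 1 *v v = (complex_of_real q ^ l1) *s v \<and> K 2 *v v = (complex_of_real q ^ l2) *s v"
    and c: "c1 \<noteq> 0" "c2 \<noteq> 0"
    and cond: "c2 / c1 \<notin> {- (complex_of_real q powi (2 * int l1 + 2 * int l2 + 1 - int m)) | m. True}"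
  shows "inj_on (\<lambda>(i, x). (complex_of_real q powi (int l1 - int l2 - 3 * int i), i + x))
             ({0..l1} \<times> {0..l2})
       \<and> (\<exists>W :: nat \<times> nat \<Rightarrow> (complex ^ 'n) set.
            direct_sum_decomp ({0..l1} \<times> {0..l2}) W \<and>
            (\<forall>(i, x) \<in> {0..l1} \<times> {0..l2}.
               is_tau c1 c2 E F K Ki (W (i, x))
                 (complex_of_real q powi (int l1 - int l2 - 3 * int i)) (i + x)))"
proof -
  obtain v :: "complex ^ 'n" where v: "v \<noteq> 0" "E 1 *v v = 0" "E 2 *v v = 0"
    "K 1 *v v = (complex_of_real q ^ l1) *s v" "K 2 *v v = (complex_of_real q ^ l2) *s v"
    using hw by blast
  interpret uq_coideal "complex_of_real q" "(*v) (E 1)" "(*v) (E 2)" "(*v) (F 1)" "(*v) (F 2)"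
    "(*v) (K 1)" "(*v) (K 2)" "(*v) (Ki 1)" "(*v) (Ki 2)" v l1 l2 c1 c2
  proof (intro uq_coideal.intro uq_hw.intro uq_hw_axioms.intro uq_coideal_axioms.intro Uq_rep_module[OF q rep] v(1-3) c(1))
    show "K 1 *v v = complex_of_real q powi int l1 *s v" "K 2 *v v = complex_of_real q powi int l2 *s v"
      unfolding power_int_of_nat by (rule v)+
  next
    fix U :: "(complex ^ 'n) set"
    assume U: "vec.subspace U" "\<And>g y. g \<in> {(*v) (E 1), (*v) (E 2), (*v) (F 1), (*v) (F 2),
        (*v) (K 1), (*v) (K 2), (*v) (Ki 1), (*v) (Ki 2)} \<Longrightarrow> y \<in> U \<Longrightarrow> g y \<in> U" "v \<in> U"
    have "invariant_subspace (U_ops E F K Ki) U"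
      unfolding invariant_subspace_def
    proof (intro conjI ballI U(1))
      fix A y assume A: "A \<in> U_ops E F K Ki" and y: "y \<in> U"
      show "A *v y \<in> U" by (rule U(2)[OF _ y]) (use A in \<open>auto simp: U_ops_def\<close>)
    qed
    then show "U = UNIV" using irr U(3) v(1) unfolding irreducible_on_def by blast
  next
    show "c2 / c1 \<noteq> - (complex_of_real q powi (2 * int l1 + 2 * int l2 + 1 - int m))" for m
      using cond by blast
  qed
  have ops: "BK K Ki *v y = bK y" "BKi K Ki *v y = bM y" "BB1 c1 E F Ki *v y = b1 c1 y" "BB2 c2 E F Ki *v y = b2 c2 y" for y
    by (simp_all add: BK_def BKi_def BB1_def BB2_def bK_def bM_def b1_def b2_def cmult_vector
      matrix_vector_mult_diff_rdistrib matrix_vector_mul_assoc[symmetric] del: One_nat_def)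
  have invariant: "invariant_subspace (B_ops c1 c2 E F K Ki) U \<longleftrightarrow>
      vec.subspace U \<and> (\<forall>A\<in>{bK, bM, b1 c1, b2 c2}. \<forall>y\<in>U. A y \<in> U)" for U
    by (simp add: invariant_subspace_def B_ops_def ops)
  obtain W where W: "direct_sum_decomp ({0..l1} \<times> {0..l2}) W" and sub:
    "\<forall>i\<le>l1. \<forall>x\<le>l2. vec.subspace (W (i, x)) \<and>
     (\<forall>A\<in>{bK, bM, b1 c1, b2 c2}. \<forall>y\<in>W (i, x). A y \<in> W (i, x)) \<and>
     vec.dim (W (i, x)) = i + x + 1 \<and>
     (\<forall>U. vec.subspace U \<longrightarrow> (\<forall>A\<in>{bK, bM, b1 c1, b2 c2}. \<forall>y\<in>U. A y \<in> U) \<longrightarrow> U \<subseteq> W (i, x) \<longrightarrow>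
       U = {0} \<or> U = W (i, x)) \<and>
     (\<exists>w\<in>W (i, x). w \<noteq> 0 \<and> b1 c1 w = 0 \<and> bK w = complex_of_real q powi (h - 3 * int i) *s w)"
    using decomposition by (elim exE conjE)
  have "is_tau c1 c2 E F K Ki (W (i, x)) (complex_of_real q powi (h - 3 * int i)) (i + x)"
    if ix: "i \<le> l1" "x \<le> l2" for i x
  proof -
    note s = sub[rule_format, OF ix]
    have "W (i, x) \<noteq> {0}" using s by blast
    then show ?thesis
      unfolding is_tau_def irreducible_on_def invariant ops using s by blast
  qed
  moreover have "inj_on (\<lambda>(i, x). (complex_of_real q powi (h - 3 * int i), i + x)) ({0..l1} \<times> {0..l2})"
    by (rule inj_onI) (auto dest: powi_inject)
  ultimately show ?thesis using W by auto
qed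

end
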